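(* Let $m\ge1$ and $P\ge3$ be two fixed integers. Let $s\in\mathcal{PS}=\mathcal{PS}(P)$ be a uniformly random $P$-angulated surface, of size $n$ if $P$ is even and of size $2n$ if $P$ is odd. Then, as $n\to\infty$, $\mathbb P(s\text{ has }m\text{ connected components})$ satisfies $$\mathbb P(s\text{ has }m\text{ connected components})\approx\begin{cases}\displaystyle\sum_{k\ge0}\mathfrak d_{k,m}(\mathcal{PS})\cdot\binom nk\cdot\frac{(P(n-k)-1)!!}{(Pn-1)!!}&\text{if }P\text{ is even},\\[2ex]\displaystyle\sum_{k\ge0}\mathfrak d_{2k,m}(\mathcal{PS})\cdot\binom{2n}{2k}\cdot\frac{(2P(n-k)-1)!!}{(2Pn-1)!!}&\text{if }P\text{ is odd},\end{cases}$$ where $$\begin{aligned}\mathfrak d_{k,m}(\mathcal{PS})&=\#\{(s',s'')\in\mathcal{PS}_i\cdot\mathcal{PS}_{k-i}\mid0\le i\le k,\ \pi_0(s')=m-1,\ \pi_0(s'')\text{ is even}\}\\&\quad-\#\{(s',s'')\in\mathcal{PS}_i\cdot\mathcal{PS}_{k-i}\mid0\le i\le k,\ \pi_0(s')=m-1,\ \pi_0(s'')\text{ is odd}\}\end{aligned}$$ and $\pi_0(s)$ is the number of connected components of the surface $s$.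
   Context: A $P$-angulated surface ($P$-angulation) of size $N$ is an oriented surface obtained by gluing $N$ unit $P$-gons along their sides; the $P$-gons are labeled by $[N]=\{1,\dots,N\}$ (or any set of size $N$), their sides are distinguishable, and any side may be glued to any other side. Combinatorially it is a perfect matching of the set of $PN$ polygon sides; so there are $(PN-1)!!$ of them if $PN$ is even and none if $PN$ is odd (with $(-1)!!=1$; for $N=0$ there is one, the empty surface, with $0$ components). Two polygons are in the same connected component if they are linked by a chain of polygons successively glued along sides. $\mathcal{PS}_i$ denotes $P$-angulated surfaces of size $i$; $(s',s'')\in\mathcal{PS}_i\cdot\mathcal{PS}_{k-i}$ means an ordered pair such that, for some decomposition $[k]=U'\sqcup U''$ with $|U'|=i$, $|U''|=k-i$, $s'$ is a $P$-angulated surface with polygons labeled by $U'$ and $s''$ one with polygons labeled by $U''$ (all decompositions are counted). Notation $\approx$: $p_n\approx\sum_{k\ge0}c_kg_k(n)$ (here $g_k(n)$ is the factor multiplying the coefficient $\mathfrak d_{k,m}$, resp. $\mathfrak d_{2k,m}$) means that $g_{k+1}(n)=o(g_k(n))$ for every $k$ and, for every integer $r\ge0$, $p_n=\sum_{k=0}^rc_kg_k(n)+O(g_{r+1}(n))$ as $n\to\infty$. *)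

theory Defs
  imports "HOL-Probability.Probability"
begin

text \<open>Written on integers so that \<open>dfact (- 1) = 1\<close> is the empty product, with no truncated
  subtraction involved.\<close>

definition dfact :: "int \<Rightarrow> nat" where
  "dfact x = (\<Prod>i | 0 < i \<and> i \<le> x \<and> even (x - i). nat i)"

text \<open>A surface is a pair of its set of polygon labels and its gluing. The sides of the polygon
  labelled \<open>u\<close> are the pairs \<open>(u, a)\<close> with \<open>a < P\<close>, and the gluing is the set of
  two-element sets of sides that are glued together. The labels are kept as a component so that
  they can be read off from a surface. Gluings respect the orientation, so the matching determines
  the oriented surface.\<close>

type_synonym surface = "nat set \<times> (nat \<times> nat) set set"

definition perfect_matchings :: "'a set \<Rightarrow> 'a set set set" where
  "perfect_matchings S = {M. partition_on S M \<and> (\<forall>e\<in>M. card e = 2)}"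

definition surfaces :: "nat \<Rightarrow> nat set \<Rightarrow> surface set" where
  "surfaces P U = {U} \<times> perfect_matchings (U \<times> {..<P})"

definition glued :: "surface \<Rightarrow> (nat \<times> nat) set" where
  "glued s = {(u, v). \<exists>a b. {(u, a), (v, b)} \<in> snd s}"

text \<open>\<^const>\<open>glued\<close> is symmetric, so its reflexive transitive closure is an equivalence relation.\<close>

definition pi0 :: "surface \<Rightarrow> nat" where
  "pi0 s = card (fst s // (glued s)\<^sup>*)"

text \<open>The ordered pairs \<open>(s', s'')\<close> in \<open>PS\<^sub>i \<cdot> PS\<^sub>j\<close>. Since each
  surface carries its labels, different decompositions contribute different pairs.\<close>

definition surface_pairs :: "nat \<Rightarrow> nat \<Rightarrow> nat \<Rightarrow> (surface \<times> surface) set" where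
  "surface_pairs P i j =
    (\<Union>(U', U'') \<in> {(U', U''). U' \<union> U'' = {1..i + j} \<and> U' \<inter> U'' = {} \<and> card U' = i \<and> card U'' = j}.
       surfaces P U' \<times> surfaces P U'')"

definition dcoeff :: "nat \<Rightarrow> nat \<Rightarrow> nat \<Rightarrow> int" where
  "dcoeff P k m =
     int (card {(s', s''). (\<exists>i\<le>k. (s', s'') \<in> surface_pairs P i (k - i)) \<and>
                           pi0 s' = m - 1 \<and> even (pi0 s'')})
   - int (card {(s', s''). (\<exists>i\<le>k. (s', s'') \<in> surface_pairs P i (k - i)) \<and>
                           pi0 s' = m - 1 \<and> odd (pi0 s'')})"

text \<open>The probability that a uniformly random surface of size \<open>N\<close> has \<open>m\<close> components; it is
  meaningful when \<open>P * N\<close> is even, as otherwise there are no surfaces.\<close>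

definition prob_components :: "nat \<Rightarrow> nat \<Rightarrow> nat \<Rightarrow> real" where
  "prob_components P N m = measure_pmf.prob (pmf_of_set (surfaces P {1..N})) {s. pi0 s = m}"

text \<open>\<open>p\<^sub>n \<approx> \<Sum>k\<ge>0. c\<^sub>k g\<^sub>k(n)\<close>\<close>

definition asymp_expansion :: "(nat \<Rightarrow> real) \<Rightarrow> (nat \<Rightarrow> real) \<Rightarrow> (nat \<Rightarrow> nat \<Rightarrow> real) \<Rightarrow> bool" where
  "asymp_expansion p c g \<longleftrightarrow>
     (\<forall>k. g (Suc k) \<in> o(g k)) \<and>
     (\<forall>r. (\<lambda>n. p n - (\<Sum>k\<le>r. c k * g k n)) \<in> O(g (Suc r)))"

end

theory Submission
  imports Defs "HOL-Computational_Algebra.Formal_Power_Series"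
begin

text \<open>Let \<open>A\<close>, \<open>C m\<close> and \<open>E\<close> be the exponential generating functions of all surfaces, of the surfaces with
  \<open>m\<close> components, and of all surfaces weighted by \<open>(- 1) ^ pi0\<close>. Splitting off the component of a
  distinguished polygon gives \<open>C (m + 1)' = C 1' * C m\<close>, hence \<open>A' = C 1' * A\<close>, \<open>E' = - C 1' * E\<close>,
  so that \<open>A * E = 1\<close> and \<open>C (m + 1)' = A' * (E * C m)\<close>. The numbers \<open>dcoeff P k m / k!\<close> are the
  coefficients of \<open>E * C (m - 1)\<close>.

  The coefficients of \<open>A\<close> grow superexponentially and are log-convex, so in a product of series of
  this growth only the terms near the two ends of the convolution matter. Therefore the map that sends
  a series to the coefficient series of its asymptotic expansion in shifts of the coefficients of
  \<open>A\<close> is a derivation: it sends \<open>A\<close> to \<open>1\<close>, hence \<open>E\<close> to \<open>- E\<^sup>2\<close>, and, by induction on \<open>m\<close>, \<open>C (m + 1)\<close> to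
  \<open>E * C m\<close>.\<close>

unbundle no vec_syntax
unbundle fps_syntax

section \<open>Asymptotic expansions in shifts of a fast growing sequence\<close>

text \<open>Positivity of \<open>w\<close> lets the finitely many exceptional indices be absorbed
  into the constant. A bound at every index is what convolutions require, since small indices occur
  in them however large \<open>n\<close> is.\<close>

lemma bigo_imp_bounded_nat:
  fixes f w :: "nat \<Rightarrow> real"
  assumes "f \<in> O(w)" and "\<And>n. w n > 0"
  obtains K where "K \<ge> 0" and "\<And>n. \<bar>f n\<bar> \<le> K * w n"
proof -
  obtain c where "c > 0" "\<forall>\<^sub>F n in at_top. norm (f n) \<le> c * norm (w n)"
    using landau_o.bigE[OF assms(1)] .
  then obtain N where c: "c > 0" "\<And>n. n \<ge> N \<Longrightarrow> \<bar>f n\<bar> \<le> c * w n"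
    using assms(2) by (auto simp: eventually_at_top_linorder less_imp_le)
  define K where "K = c + (\<Sum>n<N. \<bar>f n\<bar> / w n)"
  have "\<bar>f n\<bar> \<le> K * w n" for n
  proof (cases "n < N")
    case True
    have "\<bar>f n\<bar> / w n \<le> (\<Sum>n<N. \<bar>f n\<bar> / w n)"
      using True assms(2) by (intro member_le_sum) (auto simp: less_imp_le)
    then have "\<bar>f n\<bar> / w n \<le> K" using c(1) by (simp add: K_def)
    then show ?thesis using assms(2)[of n] by (simp add: field_simps)
  next
    case False
    have "c \<le> K" using assms(2) by (auto simp: K_def less_imp_le intro!: sum_nonneg)
    then have "c * w n \<le> K * w n" using assms(2)[of n] by (intro mult_right_mono) auto
    with c(2)[of n] False show ?thesis by simp
  qed
  moreover have "K \<ge> 0" using c(1) assms(2)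
    by (auto simp: K_def less_imp_le intro!: add_nonneg_nonneg sum_nonneg)
  ultimately show ?thesis using that by blast
qed

text \<open>The operator \<open>x d/dx\<close>. Unlike the derivative it keeps indices in place, so
  it passes to a subsequence of the coefficients up to a constant factor.\<close>

definition fps_euler :: "'a::comm_ring_1 fps \<Rightarrow> 'a fps" where
  "fps_euler F = Abs_fps (\<lambda>n. of_nat n * F $ n)"

lemma fps_euler_nth [simp]: "fps_euler F $ n = of_nat n * F $ n"
  by (simp add: fps_euler_def)

lemma fps_euler_conv_deriv: "fps_euler F = fps_X * fps_deriv F"
  by (rule fps_ext) (auto simp: fps_X_mult_nth)

lemma fps_euler_mult: "fps_euler (F * G) = fps_euler F * G + F * fps_euler G"
  by (simp add: fps_euler_conv_deriv algebra_simps)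

lemma fps_euler_1 [simp]: "fps_euler 1 = 0"
  by (rule fps_ext) auto

section \<open>Splitting a convolution into its two ends and its middle\<close>

lemma sum_triangle:
  fixes f :: "nat \<Rightarrow> nat \<Rightarrow> 'a::comm_monoid_add"
  shows "(\<Sum>i<r. \<Sum>k<r-i. f i k) = (\<Sum>l<r. \<Sum>i\<le>l. f i (l - i))"
proof -
  have "(\<Sum>i<r. \<Sum>k<r-i. f i k) = (\<Sum>(i,k)\<in>{(i,k). i + k < r}. f i k)"
    by (subst sum.Sigma) (auto intro!: sum.cong)
  also have "\<dots> = (\<Sum>l<r. \<Sum>i\<le>l. f i (l - i))"
    by (rule sum.triangle_reindex)
  finally show ?thesis .
qed

lemma fps_mult_nth_split:
  fixes F G :: "'a::comm_ring_1 fps"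
  assumes "2 * r \<le> n"
  shows "(F * G) $ n = (\<Sum>i<r. F $ i * G $ (n - i)) + (\<Sum>i<r. G $ i * F $ (n - i))
           + (\<Sum>i=r..n-r. F $ i * G $ (n - i))"
proof -
  have "(F * G) $ n = (\<Sum>i\<in>{..<r} \<union> {n-r<..n} \<union> {r..n-r}. F $ i * G $ (n - i))"
    using assms by (auto simp: fps_mult_nth intro!: sum.cong)
  also have "\<dots> = (\<Sum>i<r. F $ i * G $ (n - i)) + (\<Sum>i\<in>{n-r<..n}. F $ i * G $ (n - i))
           + (\<Sum>i=r..n-r. F $ i * G $ (n - i))"
    using assms by (subst sum.union_disjoint; (subst sum.union_disjoint)?) auto
  also have "(\<Sum>i\<in>{n-r<..n}. F $ i * G $ (n - i)) = (\<Sum>i<r. G $ i * F $ (n - i))"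
    using assms
    by (intro sum.reindex_bij_witness[of _ "\<lambda>i. n - i" "\<lambda>i. n - i"]) (auto simp: mult.commute)
  finally show ?thesis .
qed

text \<open>Monotone ratios mean log-convex coefficients, which make the outer terms of the
  convolution \<open>A * A\<close> the largest; the linear lower bound on the ratios outweighs the
  number of terms.\<close>

locale superexponential_growth =
  fixes A :: "real fps" and \<rho> :: "nat \<Rightarrow> real"
  assumes A_0: "A $ 0 = 1"
    and A_Suc: "A $ Suc n = \<rho> n * A $ n"
    and mono_ratio: "mono \<rho>"
    and ratio_ge: "\<rho> n \<ge> real (Suc n)"
begin

lemma ratio_pos: "\<rho> n > 0"
  using ratio_ge[of n] by linarith

lemma A_pos: "A $ n > 0"
  by (induction n) (auto simp: A_0 A_Suc ratio_pos)

lemma A_Suc_ge: "real (Suc n) * A $ n \<le> A $ Suc n"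
  using ratio_ge[of n] A_pos[of n] by (simp add: A_Suc)

lemma A_step: "n \<le> m \<Longrightarrow> A $ Suc n * A $ m \<le> A $ n * A $ Suc m"
proof -
  assume "n \<le> m"
  then have "\<rho> n \<le> \<rho> m" using mono_ratio by (simp add: monoD)
  then have "\<rho> n * (A $ n * A $ m) \<le> \<rho> m * (A $ n * A $ m)"
    using A_pos by (intro mult_right_mono) (auto intro: less_imp_le)
  then show ?thesis by (simp add: A_Suc algebra_simps)
qed

text \<open>Iterates \<open>A_step\<close>: moving one unit from the smaller index to the larger one
  never decreases the product.\<close>

lemma A_log_convex: "i \<le> j \<Longrightarrow> 2 * j \<le> n \<Longrightarrow> A $ j * A $ (n - j) \<le> A $ i * A $ (n - i)"
proof (induction j rule: dec_induct)
  case (step j)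
  have "A $ Suc j * A $ (n - Suc j) \<le> A $ j * A $ Suc (n - Suc j)"
    using step by (intro A_step) auto
  also have "Suc (n - Suc j) = n - j" using step by auto
  finally show ?case using step by auto
qed auto

lemma A_log_convex':
  assumes "r \<le> i" "i \<le> n - r" "2 * r \<le> n"
  shows "A $ i * A $ (n - i) \<le> A $ r * A $ (n - r)"
proof (cases "2 * i \<le> n")
  case False
  then show ?thesis using A_log_convex[of r "n - i" n] assms by (simp add: mult.commute)
qed (use A_log_convex[of r i n] assms in auto)

text \<open>Only \<open>i = r\<close> and \<open>i = n - r\<close> give the full size
  \<open>A $ r * A $ (n - r)\<close>. The fewer than \<open>n\<close> other terms are at most
  \<open>A $ Suc r * A $ (n - Suc r)\<close>, and the growth ratio of at least \<open>n - r\<close>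
  absorbs their number.\<close>

lemma middle_sum_bound:
  obtains K where "\<And>n. 2 * r \<le> n \<Longrightarrow> (\<Sum>i=r..n-r. A $ i * A $ (n - i)) \<le> K * A $ (n - r)"
proof
  let ?K = "2 * A $ r + 2 * A $ Suc r"
  fix n assume n: "2 * r \<le> n"
  let ?f = "\<lambda>i. A $ i * A $ (n - i)"
  consider "n = 2 * r" | "n = 2 * r + 1" | "n \<ge> 2 * r + 2" using n by linarith
  then show "sum ?f {r..n-r} \<le> ?K * A $ (n - r)"
  proof cases
    case 1
    then show ?thesis using A_pos[of r] A_pos[of "Suc r"] by (simp add: algebra_simps)
  next
    case 2
    then have "{r..n-r} = {r, Suc r}" by auto
    with 2 show ?thesis using A_pos[of r] A_pos[of "Suc r"] by (simp add: algebra_simps)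
  next
    case 3
    have "{r..n-r} = {r, n-r} \<union> {Suc r..n - Suc r}" using 3 by auto
    then have "sum ?f {r..n-r} = sum ?f {r, n-r} + sum ?f {Suc r..n - Suc r}"
      using 3 by (simp only:) (rule sum.union_disjoint, auto)
    also have "sum ?f {r, n-r} = 2 * A $ r * A $ (n - r)"
      using 3 by (subst sum.insert) auto
    also have "sum ?f {Suc r..n - Suc r} \<le> (\<Sum>i=Suc r..n - Suc r. A $ Suc r * A $ (n - Suc r))"
      using 3 by (intro sum_mono A_log_convex') auto
    also have "\<dots> \<le> A $ Suc r * (real n * A $ (n - Suc r))"
      using 3 A_pos[of "Suc r"] A_pos[of "n - Suc r"] by (auto intro!: mult_right_mono)
    \<comment> \<open>Here \<open>n \<le> 2 * (n - r)\<close> because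
      \<open>2 * r \<le> n\<close>.\<close>
    also have "real n * A $ (n - Suc r) \<le> 2 * (real (n - r) * A $ (n - Suc r))"
      using 3 A_pos[of "n - Suc r"] by (auto simp: mult.assoc[symmetric] intro!: mult_right_mono)
    also have "real (n - r) * A $ (n - Suc r) \<le> A $ (n - r)"
      using A_Suc_ge[of "n - Suc r"] 3 by (simp add: Suc_diff_Suc)
    finally show ?thesis using A_pos[of "Suc r"] by (simp add: algebra_simps)
  qed
qed

text \<open>The order \<open>r\<close> is a parameter so that induction on it is possible. Order
  \<open>0\<close> only says that \<open>F\<close> is \<open>O(A)\<close>; truncation in
  \<open>n - k\<close> affects finitely many \<open>n\<close>.\<close>

definition has_expansion :: "nat \<Rightarrow> real fps \<Rightarrow> real fps \<Rightarrow> bool" where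
  "has_expansion r F G \<longleftrightarrow>
     (\<lambda>n. F $ n - (\<Sum>k<r. G $ k * A $ (n - k))) \<in> O(\<lambda>n. A $ (n - r))"

text \<open>Each \<open>H $ (n - i)\<close> is expanded to order \<open>r - i\<close>, so that every
  remainder is of size \<open>A $ (n - r)\<close>, and terms with equal \<open>i + k\<close> are
  collected. If \<open>F $ 0 = 0\<close>, only orders of \<open>H\<close> below \<open>r\<close>
  enter.\<close>

lemma shift_sum_expansion:
  assumes "\<And>i. i < r \<Longrightarrow> F $ i \<noteq> 0 \<Longrightarrow> has_expansion (r - i) H G"
  shows "(\<lambda>n. (\<Sum>i<r. F $ i * H $ (n - i)) - (\<Sum>k<r. (F * G) $ k * A $ (n - k)))
           \<in> O(\<lambda>n. A $ (n - r))"
proof -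
  have shift: "filterlim (\<lambda>n. n - i) sequentially sequentially" for i :: nat
    by (rule filterlim_minus_const_nat_at_top)
  have "(\<lambda>n. (\<Sum>i<r. F $ i * (H $ (n - i) - (\<Sum>k<r-i. G $ k * A $ (n - i - k)))))
           \<in> O(\<lambda>n. A $ (n - r))"
  proof (rule big_sum_in_bigo)
    fix i assume "i \<in> {..<r}"
    then have i: "i < r" by simp
    show "(\<lambda>n. F $ i * (H $ (n - i) - (\<Sum>k<r-i. G $ k * A $ (n - i - k)))) \<in> O(\<lambda>n. A $ (n - r))"
    proof (cases "F $ i = 0")
      case False
      then have "(\<lambda>n. H $ n - (\<Sum>k<r-i. G $ k * A $ (n - k))) \<in> O(\<lambda>n. A $ (n - (r - i)))"
        using assms i by (simp add: has_expansion_def)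
      from landau_o.big.compose[OF this shift[of i]] show ?thesis
        using i False by (simp add: landau_o.big.cmult_in_iff)
    qed simp
  qed
  also have "(\<lambda>n. (\<Sum>i<r. F $ i * (H $ (n - i) - (\<Sum>k<r-i. G $ k * A $ (n - i - k))))) =
     (\<lambda>n. (\<Sum>i<r. F $ i * H $ (n - i)) - (\<Sum>k<r. (F * G) $ k * A $ (n - k)))"
  proof
    fix n
    have "(\<Sum>i<r. \<Sum>k<r-i. F $ i * G $ k * A $ (n - i - k))
            = (\<Sum>l<r. \<Sum>i\<le>l. F $ i * G $ (l - i) * A $ (n - i - (l - i)))"
      by (rule sum_triangle)
    also have "\<dots> = (\<Sum>l<r. (F * G) $ l * A $ (n - l))"
      by (intro sum.cong refl) (auto simp: fps_mult_nth sum_distrib_right atMost_atLeast0 intro!: sum.cong)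
    finally show "(\<Sum>i<r. F $ i * (H $ (n - i) - (\<Sum>k<r-i. G $ k * A $ (n - i - k)))) =
      (\<Sum>i<r. F $ i * H $ (n - i)) - (\<Sum>k<r. (F * G) $ k * A $ (n - k))"
      by (simp add: right_diff_distrib sum_subtractf sum_distrib_left mult.assoc)
  qed
  finally show ?thesis .
qed

text \<open>The absolute values stay inside the sum so that the bound survives an additional weight
  on the terms.\<close>

lemma middle_product_bigo:
  assumes "fps_nth F \<in> O(fps_nth A)" "fps_nth H \<in> O(fps_nth A)"
  shows "(\<lambda>n. \<Sum>i=r..n-r. \<bar>F $ i * H $ (n - i)\<bar>) \<in> O(\<lambda>n. A $ (n - r))"
proof -
  obtain K where K: "K \<ge> 0" "\<And>n. \<bar>F $ n\<bar> \<le> K * A $ n"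
    using bigo_imp_bounded_nat[OF assms(1) A_pos] by blast
  obtain L where L: "L \<ge> 0" "\<And>n. \<bar>H $ n\<bar> \<le> L * A $ n"
    using bigo_imp_bounded_nat[OF assms(2) A_pos] by blast
  obtain M where M: "\<And>n. 2 * r \<le> n \<Longrightarrow> (\<Sum>i=r..n-r. A $ i * A $ (n - i)) \<le> M * A $ (n - r)"
    using middle_sum_bound[of r] by blast
  have "(\<Sum>i=r..n-r. \<bar>F $ i * H $ (n - i)\<bar>) \<le> K * L * M * A $ (n - r)" if "2 * r \<le> n" for n
  proof -
    have "(\<Sum>i=r..n-r. \<bar>F $ i * H $ (n - i)\<bar>) \<le> (\<Sum>i=r..n-r. (K * A $ i) * (L * A $ (n - i)))"
      unfolding abs_mult using K L A_pos by (intro sum_mono mult_mono) (simp_all add: less_imp_le)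
    also have "\<dots> = K * L * (\<Sum>i=r..n-r. A $ i * A $ (n - i))"
      by (simp add: sum_distrib_left algebra_simps)
    also have "\<dots> \<le> K * L * (M * A $ (n - r))"
      using K L M[OF that] by (intro mult_left_mono) auto
    finally show ?thesis by (simp add: algebra_simps)
  qed
  then show ?thesis
    using A_pos by (intro bigoI[of _ "K * L * M"] eventually_at_top_linorderI[of "2 * r"])
      (auto simp: abs_of_pos)
qed

text \<open>The product rule: the end where \<open>F\<close> has small index contributes
  \<open>F * H'\<close>, the other end \<open>H * F'\<close>, and the middle belongs to the
  error.\<close>

lemma has_expansion_mult:
  assumes "fps_nth F \<in> O(fps_nth A)" "fps_nth H \<in> O(fps_nth A)"
    and "\<And>i. i < r \<Longrightarrow> F $ i \<noteq> 0 \<Longrightarrow> has_expansion (r - i) H H'"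
    and "\<And>i. i < r \<Longrightarrow> H $ i \<noteq> 0 \<Longrightarrow> has_expansion (r - i) F F'"
  shows "has_expansion r (F * H) (F * H' + H * F')"
proof -
  let ?m = "\<lambda>n. \<Sum>i=r..n-r. F $ i * H $ (n - i)"
  have "(\<lambda>n. \<Sum>i=r..n-r. F $ i * H $ (n - i)) \<in> O(\<lambda>n. \<Sum>i=r..n-r. \<bar>F $ i * H $ (n - i)\<bar>)"
    by (intro landau_o.big_mono always_eventually) (auto intro: order_trans[OF sum_abs])
  from landau_o.big_trans[OF this middle_product_bigo[OF assms(1,2)]]
  have "?m \<in> O(\<lambda>n. A $ (n - r))" .
  from sum_in_bigo(1)[OF sum_in_bigo(1)[OF shift_sum_expansion[OF assms(3)]
      shift_sum_expansion[OF assms(4)]] this]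
  have *: "(\<lambda>n. (\<Sum>i<r. F $ i * H $ (n - i)) - (\<Sum>k<r. (F * H') $ k * A $ (n - k))
     + ((\<Sum>i<r. H $ i * F $ (n - i)) - (\<Sum>k<r. (H * F') $ k * A $ (n - k))) + ?m n)
     \<in> O(\<lambda>n. A $ (n - r))" by simp
  show ?thesis unfolding has_expansion_def
    by (rule landau_o.big.in_cong[THEN iffD1, OF _ *], rule eventually_at_top_linorderI[of "2*r"])
      (simp add: fps_mult_nth_split sum.distrib algebra_simps)
qed

lemma has_expansion_0_iff: "has_expansion 0 F G \<longleftrightarrow> fps_nth F \<in> O(fps_nth A)"
  by (simp add: has_expansion_def)

text \<open>Rewrite \<open>A * E = 1\<close> as \<open>(A - 1) * E = 1 - E\<close>. Since
  \<open>A - 1\<close> has zero constant term, the order \<open>r\<close> expansion of the left side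
  uses only orders below \<open>r\<close> for \<open>E\<close>, which makes the induction
  work.\<close>

lemma has_expansion_reciprocal:
  assumes "A * E = 1" and E: "fps_nth E \<in> O(fps_nth A)"
  shows "has_expansion r E (- (E ^ 2))"
proof (induction r rule: less_induct)
  case (less r)
  show ?case
  proof (cases "r = 0")
    case True
    then show ?thesis using E by (simp add: has_expansion_0_iff)
  next
    case False
    \<comment> \<open>\<open>A - 1\<close> differs from \<open>A\<close> only at index
      \<open>0\<close>, so the expansion with coefficient series \<open>1\<close> is exact for
      \<open>n > 0\<close>.\<close>
    have A1_eq: "(A - 1) $ n - (\<Sum>k<s. (1::real fps) $ k * A $ (n - k)) = 0" if "s > 0" "n > 0" for s n
    proof -
      have "(\<Sum>k<s. (1::real fps) $ k * A $ (n - k)) = (\<Sum>k<s. if k = 0 then A $ n else 0)"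
        by (intro sum.cong) auto
      then show ?thesis using that by simp
    qed
    have A1: "has_expansion s (A - 1) 1" if "s > 0" for s
      unfolding has_expansion_def
      by (intro bigoI[of _ 1] eventually_at_top_linorderI[of 1]) (use A1_eq[OF that] A_pos in \<open>simp add: less_imp_le\<close>)
    have bounded: "fps_nth (A - 1) \<in> O(fps_nth A)"
      by (intro bigoI[of _ 1] eventually_at_top_linorderI[of 1]) auto
    have "has_expansion r ((A - 1) * E) ((A - 1) * (- (E ^ 2)) + E * 1)"
      using False by (intro has_expansion_mult bounded E)
        (auto intro!: less A1 simp: A_0 split: if_splits dest: gr0I)
    also have "(A - 1) * (- (E ^ 2)) + E * 1 = E ^ 2 + (1 - A * E) * E"
      by (simp add: algebra_simps power2_eq_square)
    also have "(A - 1) * E = 1 - E" using assms by (simp add: algebra_simps)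
    finally have "(\<lambda>n. (1 - E) $ n - (\<Sum>k<r. (E ^ 2) $ k * A $ (n - k))) \<in> O(\<lambda>n. A $ (n - r))"
      using assms by (simp add: has_expansion_def)
    then have *: "(\<lambda>n. - ((1 - E) $ n - (\<Sum>k<r. (E ^ 2) $ k * A $ (n - k)))) \<in> O(\<lambda>n. A $ (n - r))"
      by (simp only: landau_o.big.uminus_in_iff)
    show ?thesis unfolding has_expansion_def
      by (rule landau_o.big.in_cong[THEN iffD1, OF _ *], rule eventually_at_top_linorderI[of 1])
        (simp add: sum_negf)
  qed
qed

text \<open>The coefficient \<open>n * C $ n\<close> is a convolution of \<open>j * A $ j\<close> with \<open>D\<close>. Its terms with \<open>j\<close> near
  \<open>n\<close> contribute \<open>(n - k) * D $ k * A $ (n - k)\<close>; by the hypothesis on \<open>D'\<close>, those with \<open>j\<close> near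
  \<open>0\<close> contribute exactly the missing \<open>k * D $ k * A $ (n - k)\<close>.\<close>

lemma has_expansion_integrate:
  assumes CD: "fps_euler C = fps_euler A * D"
    and D: "\<And>r. has_expansion r D D'"
    and D': "fps_euler D = fps_euler A * D'"
  shows "has_expansion r C D"
proof -
  let ?g = "\<lambda>n. A $ (n - r)"
  let ?m = "\<lambda>n. \<Sum>i=r..n-r. (real i * A $ i) * D $ (n - i)"
  \<comment> \<open>The weight \<open>i\<close> is at most \<open>n\<close> and costs one factor
    \<open>n\<close>. All errors may carry this factor, because the identity is divided by
    \<open>n\<close> at the end.\<close>
  have bound: "?m \<in> O(\<lambda>n. real n * ?g n)"
  proof -
    have "fps_nth D \<in> O(fps_nth A)" using D[of 0] by (simp add: has_expansion_0_iff)
    from middle_product_bigo[OF _ this, of A r]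
    have *: "(\<lambda>n. \<Sum>i=r..n-r. \<bar>A $ i * D $ (n - i)\<bar>) \<in> O(?g)" by simp
    have le: "\<bar>?m n\<bar> \<le> real n * (\<Sum>i=r..n-r. \<bar>A $ i * D $ (n - i)\<bar>)" for n
    proof -
      have "\<bar>?m n\<bar> \<le> (\<Sum>i=r..n-r. \<bar>(real i * A $ i) * D $ (n - i)\<bar>)" by (rule sum_abs)
      also have "\<dots> \<le> (\<Sum>i=r..n-r. real n * \<bar>A $ i * D $ (n - i)\<bar>)"
        by (intro sum_mono) (auto simp: abs_mult mult.assoc intro!: mult_right_mono)
      finally show ?thesis by (simp add: sum_distrib_left)
    qed
    have "?m \<in> O(\<lambda>n. real n * (\<Sum>i=r..n-r. \<bar>A $ i * D $ (n - i)\<bar>))"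
      using le by (intro landau_o.big_mono always_eventually) (auto intro: order_trans[OF _ abs_ge_self])
    also have "(\<lambda>n. real n * (\<Sum>i=r..n-r. \<bar>A $ i * D $ (n - i)\<bar>)) \<in> O(\<lambda>n. real n * ?g n)"
      using * by (intro landau_o.big.mult) auto
    finally show ?thesis .
  qed
  have "(\<lambda>n. (\<Sum>i<r. fps_euler A $ i * D $ (n - i)) - (\<Sum>k<r. fps_euler D $ k * A $ (n - k))) \<in> O(?g)"
    unfolding D' using D by (intro shift_sum_expansion) auto
  also have "?g \<in> O(\<lambda>n. real n * ?g n)"
    by (intro bigoI[of _ 1] eventually_at_top_linorderI[of 1])
      (use A_pos in \<open>auto simp: abs_mult abs_of_pos intro!: mult_right_mono[of 1, simplified] less_imp_le\<close>)
  finally have "(\<lambda>n. (\<Sum>i<r. fps_euler A $ i * D $ (n - i)) - (\<Sum>k<r. fps_euler D $ k * A $ (n - k)))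
     \<in> O(\<lambda>n. real n * ?g n)" .
  from sum_in_bigo(1)[OF this bound]
  have *: "(\<lambda>n. (\<Sum>i<r. fps_euler A $ i * D $ (n - i)) - (\<Sum>k<r. fps_euler D $ k * A $ (n - k)) + ?m n)
     \<in> O(\<lambda>n. real n * ?g n)" .
  have eq: "(\<Sum>i<r. fps_euler A $ i * D $ (n - i)) - (\<Sum>k<r. fps_euler D $ k * A $ (n - k)) + ?m n
     = real n * (C $ n - (\<Sum>k<r. D $ k * A $ (n - k)))" if n: "2 * r \<le> n" for n
  proof -
    have "real n * C $ n = (fps_euler A * D) $ n" by (simp flip: CD)
    also have "\<dots> = (\<Sum>i<r. fps_euler A $ i * D $ (n - i))
        + (\<Sum>i<r. D $ i * (real (n - i) * A $ (n - i))) + ?m n"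
      using n by (simp add: fps_mult_nth_split)
    also have "(\<Sum>i<r. D $ i * (real (n - i) * A $ (n - i)))
        = (\<Sum>k<r. real n * (D $ k * A $ (n - k)) - fps_euler D $ k * A $ (n - k))"
      using n by (intro sum.cong) (auto simp: of_nat_diff algebra_simps)
    finally show ?thesis by (simp add: sum_subtractf sum_distrib_left right_diff_distrib)
  qed
  have "(\<lambda>n. real n * (C $ n - (\<Sum>k<r. D $ k * A $ (n - k)))) \<in> O(\<lambda>n. real n * ?g n)"
    by (rule landau_o.big.in_cong[THEN iffD1, OF _ *], rule eventually_at_top_linorderI[of "2*r"])
      (simp only: eq)
  then show ?thesis unfolding has_expansion_def
    by (subst (asm) landau_o.big.mult_cancel_left) (auto intro!: eventually_at_top_linorderI[of 1])
qed

text \<open>Dividing \<open>fps_euler F\<close> by \<open>fps_euler A\<close> and passing to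
  expansion coefficients are both derivations sending \<open>A\<close> to \<open>1\<close>. Hence
  the coefficient series of \<open>C m\<close> is also its Euler quotient, which is the hypothesis
  of \<open>has_expansion_integrate\<close> for the next \<open>m\<close>.\<close>

lemma has_expansion_components:
  assumes AE: "A * E = 1" and E: "fps_nth E \<in> O(fps_nth A)"
    and C0: "C 0 = 1"
    and C_Suc: "\<And>m. fps_euler (C (Suc m)) = fps_euler A * (E * C m)"
  shows "has_expansion r (C (Suc m)) (E * C m)"
proof -
  have exp_E: "has_expansion r E (- (E ^ 2))" for r
    using has_expansion_reciprocal[OF AE E] .
  have euler_E: "fps_euler E = - (fps_euler A * E ^ 2)"
  proof -
    have "fps_euler E = (A * E) * fps_euler E" using AE by simp
    also have "\<dots> = E * (A * fps_euler E)" by (simp add: algebra_simps)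
    also have "A * fps_euler E = - (fps_euler A * E)"
      using fps_euler_mult[of A E] AE by (simp add: eq_neg_iff_add_eq_0 add.commute)
    finally show ?thesis by (simp add: power2_eq_square algebra_simps)
  qed
  \<comment> \<open>\<open>D2\<close> is both the coefficient series and the Euler quotient of
    \<open>C2\<close>; the two product rules then give the same series for
    \<open>E * C2\<close>.\<close>
  have step: "has_expansion r C1 (E * C2)"
    if "fps_euler C1 = fps_euler A * (E * C2)" "\<And>r. has_expansion r C2 D2"
      "fps_euler C2 = fps_euler A * D2" for C1 C2 D2 r
  proof (rule has_expansion_integrate[OF that(1)])
    show "has_expansion r (E * C2) (E * D2 + C2 * (- (E ^ 2)))" for r
      using that(2) has_expansion_0_iff exp_E E by (intro has_expansion_mult) auto
    show "fps_euler (E * C2) = fps_euler A * (E * D2 + C2 * (- (E ^ 2)))"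
      by (simp add: fps_euler_mult euler_E that(3) algebra_simps)
  qed
  show ?thesis
  proof (induction m arbitrary: r)
    case 0
    have "has_expansion r 1 0" for r
      unfolding has_expansion_def
      by (intro bigoI[of _ 1] eventually_at_top_linorderI[of 1]) auto
    then show ?case using C_Suc[of 0] by (intro step[of _ _ 0]) (auto simp: C0)
  next
    case (Suc m)
    show ?case by (rule step[OF C_Suc Suc.IH C_Suc])
  qed
qed

lemma shift_ratio_smallo: "(\<lambda>n. A $ (n - Suc k)) \<in> o(\<lambda>n. A $ (n - k))"
proof (rule landau_o.smallI)
  fix c :: real assume c: "c > 0"
  \<comment> \<open>Consecutive shifts differ by a factor of at least \<open>n - k\<close>, which
    has to exceed \<open>1 / c\<close>.\<close>
  obtain N where N: "real N > 1 / c" using reals_Archimedean2 by blast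
  show "\<forall>\<^sub>F n in sequentially. norm (A $ (n - Suc k)) \<le> c * norm (A $ (n - k))"
  proof (rule eventually_at_top_linorderI[of "N + Suc k"])
    fix n assume n: "n \<ge> N + Suc k"
    have "1 / c \<le> real (n - k)" using N n by simp
    then have "1 \<le> c * real (n - k)" using c by (simp add: divide_le_eq mult.commute del: of_nat_diff)
    from mult_right_mono[OF this less_imp_le[OF A_pos]]
    have "1 * A $ (n - Suc k) \<le> c * real (n - k) * A $ (n - Suc k)" .
    also have "\<dots> \<le> c * A $ (n - k)"
      using mult_left_mono[OF A_Suc_ge[of "n - Suc k"], of c] n c
      by (simp add: Suc_diff_Suc del: of_nat_Suc of_nat_diff)
    finally show "norm (A $ (n - Suc k)) \<le> c * norm (A $ (n - k))"
      using A_pos by (simp add: abs_of_pos)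
  qed
qed

end

section \<open>Perfect matchings and double factorials\<close>

lemma perfect_matchings_empty [simp]: "perfect_matchings {} = {{}}"
  by (auto simp: perfect_matchings_def partition_on_empty)

lemma finite_perfect_matchings:
  assumes "finite S"
  shows "finite (perfect_matchings S)"
proof (rule finite_subset)
  show "perfect_matchings S \<subseteq> Pow (Pow S)"
    by (auto simp: perfect_matchings_def partition_on_def)
qed (use assms in simp)

lemma perfect_matchings_remove:
  assumes "x \<in> S"
  shows "perfect_matchings S = (\<Union>y\<in>S-{x}. insert {x, y} ` perfect_matchings (S - {x, y}))"
proof (intro equalityI subsetI)
  fix M assume M: "M \<in> perfect_matchings S"
  then have part: "partition_on S M" and two: "\<And>e. e \<in> M \<Longrightarrow> card e = 2"
    by (auto simp: perfect_matchings_def)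
  from assms obtain e where e: "e \<in> M" "x \<in> e" using part by (auto simp: partition_on_def)
  obtain y where y: "e = {x, y}" "y \<noteq> x"
    using two[OF e(1)] e(2) by (auto simp: card_2_iff)
  have "disjnt {x, y} (\<Union>(M - {e}))"
  proof -
    have "e \<inter> e' = {}" if "e' \<in> M - {e}" for e'
      using disjointD[OF partition_onD2[OF part] e(1), of e'] that by auto
    then show ?thesis unfolding disjnt_def y(1)[symmetric] by auto
  qed
  moreover have M_eq: "M = insert {x, y} (M - {e})" using e y by auto
  ultimately have "partition_on (S - {x, y}) (M - {e}) \<and> {x, y} \<subseteq> S"
    using part partition_on_insert[of "{x, y}" "M - {e}" S] by simp
  then have "M - {e} \<in> perfect_matchings (S - {x, y})" "y \<in> S - {x}"
    using two y by (auto simp: perfect_matchings_def)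
  with M_eq show "M \<in> (\<Union>y\<in>S-{x}. insert {x, y} ` perfect_matchings (S - {x, y}))" by blast
next
  fix M assume "M \<in> (\<Union>y\<in>S-{x}. insert {x, y} ` perfect_matchings (S - {x, y}))"
  then obtain y N where y: "y \<in> S" "y \<noteq> x" and N: "N \<in> perfect_matchings (S - {x, y})"
    and M: "M = insert {x, y} N" by auto
  have "disjnt {x, y} (\<Union>N)"
    using N by (auto simp: perfect_matchings_def partition_on_def disjnt_def)
  then have "partition_on S M"
    using partition_on_insert[of "{x, y}" N S] N y assms by (simp add: M perfect_matchings_def)
  then show "M \<in> perfect_matchings S" using N y by (auto simp: M perfect_matchings_def)
qed

text \<open>The matching determines the partner of \<open>x\<close>, so different partners give
  disjoint families; inserting a block is injective because no matching of the remaining points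
  contains it.\<close>

lemma card_perfect_matchings_remove:
  assumes "finite S" "x \<in> S" and "\<And>y. y \<in> S - {x} \<Longrightarrow> card (perfect_matchings (S - {x, y})) = c"
  shows "card (perfect_matchings S) = (card S - 1) * c"
proof -
  let ?F = "\<lambda>y. insert {x, y} ` perfect_matchings (S - {x, y})"
  have notin: "{x, z} \<notin> N" if "N \<in> perfect_matchings (S - {x, y})" for N y z
    using that by (auto simp: perfect_matchings_def partition_on_def)
  have "card (\<Union>y\<in>S-{x}. ?F y) = (\<Sum>y\<in>S-{x}. card (?F y))"
  proof (rule card_UN_disjoint)
    show "\<forall>y\<in>S-{x}. \<forall>z\<in>S-{x}. y \<noteq> z \<longrightarrow> ?F y \<inter> ?F z = {}"
    proof (intro ballI impI)
      fix y z assume "y \<in> S - {x}" "z \<in> S - {x}" "y \<noteq> z"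
      then have ne: "{x, y} \<noteq> {x, z}" by (auto simp: doubleton_eq_iff)
      show "?F y \<inter> ?F z = {}"
      proof (rule ccontr)
        assume "?F y \<inter> ?F z \<noteq> {}"
        then obtain X where "X \<in> ?F y" "X \<in> ?F z" by (meson disjoint_iff)
        then obtain N N' where N: "N' \<in> perfect_matchings (S - {x, z})"
          "X = insert {x, y} N" "X = insert {x, z} N'" by (elim imageE)
        then have "{x, y} \<in> N'" using ne by (metis insert_iff)
        then show False using notin[OF N(1)] by blast
      qed
    qed
  qed (use assms finite_perfect_matchings[of "S - {x, _}"] in auto)
  also have "\<dots> = (\<Sum>y\<in>S-{x}. c)"
  proof (rule sum.cong)
    fix y assume "y \<in> S - {x}"
    moreover have "inj_on (insert {x, y}) (perfect_matchings (S - {x, y}))"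
      using notin by (intro inj_onI) (metis insert_ident)
    ultimately show "card (?F y) = c" using assms by (simp add: card_image)
  qed simp
  finally show ?thesis using assms perfect_matchings_remove[of x S] by simp
qed

lemma dfact_nonpos: "x \<le> 0 \<Longrightarrow> dfact x = 1"
proof -
  assume "x \<le> 0"
  then have "{i. 0 < i \<and> i \<le> x \<and> even (x - i)} = {}" by auto
  then show ?thesis by (simp only: dfact_def prod.empty)
qed

lemma dfact_rec:
  assumes "x > 0"
  shows "dfact x = nat x * dfact (x - 2)"
proof -
  have "{i. 0 < i \<and> i \<le> x \<and> even (x - i)} = insert x {i. 0 < i \<and> i \<le> x - 2 \<and> even (x - 2 - i)}"
    (is "_ = insert x ?B")
  proof (intro equalityI subsetI)
    fix i assume "i \<in> {i. 0 < i \<and> i \<le> x \<and> even (x - i)}"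
    then show "i \<in> insert x ?B" by simp presburger
  qed (use assms in auto)
  moreover have "finite ?B" by (rule finite_subset[of _ "{0..x}"]) auto
  ultimately show ?thesis by (simp add: dfact_def)
qed

lemma dfact_pos: "dfact x > 0"
  by (auto simp: dfact_def intro!: prod_pos)

lemma card_perfect_matchings:
  assumes "finite S"
  shows "card (perfect_matchings S) = (if even (card S) then dfact (int (card S) - 1) else 0)"
  using assms
proof (induction "card S" arbitrary: S rule: less_induct)
  case less
  show ?case
  proof (cases "S = {}")
    case True
    then show ?thesis by (simp add: dfact_nonpos)
  next
    case False
    then obtain x where x: "x \<in> S" by auto
    \<comment> \<open>Two points fewer turn \<open>card S - 1\<close> into
      \<open>card S - 3\<close>; for \<open>card S = 2\<close> this is the value
      \<open>dfact (- 1) = 1\<close>.\<close>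
    let ?c = "if even (card S) then dfact (int (card S) - 3) else 0"
    have "card (perfect_matchings (S - {x, y})) = ?c" if y: "y \<in> S - {x}" for y
    proof -
      have "card S = card (S - {x, y}) + 2"
        using less.prems x y card_Diff_subset[of "{x, y}" S] card_mono[of S "{x, y}"] by auto
      then show ?thesis using less.hyps[of "S - {x, y}"] less.prems by (simp add: algebra_simps)
    qed
    from card_perfect_matchings_remove[OF less.prems x this]
    have "card (perfect_matchings S) = (card S - 1) * ?c" .
    moreover have "card S > 0" using less.prems False by (simp add: card_gt_0_iff)
    ultimately show ?thesis
      using dfact_rec[of "int (card S) - 1"] by (auto simp: nat_diff_distrib elim!: oddE evenE)
  qed
qed

section \<open>Unions, restrictions and images of matchings\<close>

lemma perfect_matchings_iff:
  "M \<in> perfect_matchings S \<longleftrightarrow>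
     \<Union>M = S \<and> (\<forall>e\<in>M. card e = 2) \<and> (\<forall>e\<in>M. \<forall>e'\<in>M. e \<inter> e' \<noteq> {} \<longrightarrow> e = e')"
  unfolding perfect_matchings_def partition_on_def disjoint_def by auto

lemma perfect_matchings_Un:
  assumes "M \<in> perfect_matchings S" "N \<in> perfect_matchings T" "S \<inter> T = {}"
  shows "M \<union> N \<in> perfect_matchings (S \<union> T)"
proof -
  have "e \<inter> e' = {}" if "e \<in> M" "e' \<in> N" for e e'
  proof -
    have "e \<subseteq> S" "e' \<subseteq> T" using that assms by (auto simp: perfect_matchings_iff)
    then show ?thesis using assms(3) by auto
  qed
  moreover from this have "e \<inter> e' = {}" if "e \<in> N" "e' \<in> M" for e e'
    using that by (metis Int_commute)
  ultimately show ?thesis using assms(1,2) unfolding perfect_matchings_iff by (simp add: ball_Un)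
qed

text \<open>The block of a point of \<open>S\<close> cannot lie inside \<open>T\<close>, so the
  blocks inside \<open>S\<close> already cover \<open>S\<close>.\<close>

lemma perfect_matchings_restrict:
  assumes M: "M \<in> perfect_matchings (S \<union> T)" and "S \<inter> T = {}"
    and "\<And>e. e \<in> M \<Longrightarrow> e \<subseteq> S \<or> e \<subseteq> T"
  shows "{e \<in> M. e \<subseteq> S} \<in> perfect_matchings S"
proof -
  have "S \<subseteq> \<Union>{e \<in> M. e \<subseteq> S}"
  proof
    fix x assume x: "x \<in> S"
    then have "x \<in> \<Union>M" using M by (simp add: perfect_matchings_iff)
    then obtain e where "e \<in> M" "x \<in> e" by blast
    moreover from this have "e \<subseteq> S" using assms(2,3) x by blast
    ultimately show "x \<in> \<Union>{e \<in> M. e \<subseteq> S}" by auto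
  qed
  then have "\<Union>{e \<in> M. e \<subseteq> S} = S" by auto
  then show ?thesis using M unfolding perfect_matchings_iff by simp
qed

lemma perfect_matchings_Un_restrict:
  assumes M: "M \<in> perfect_matchings S" and N: "N \<in> perfect_matchings T" and "S \<inter> T = {}"
  shows "{e \<in> M \<union> N. e \<subseteq> S} = M"
proof -
  have "\<not> e \<subseteq> S" if "e \<in> N" for e
  proof
    assume "e \<subseteq> S"
    moreover have "e \<subseteq> T" "e \<noteq> {}" using N that by (auto simp: perfect_matchings_iff)
    ultimately show False using assms(3) by auto
  qed
  moreover have "e \<subseteq> S" if "e \<in> M" for e using M that by (auto simp: perfect_matchings_iff)
  ultimately show ?thesis by auto
qed

lemma perfect_matchings_image:
  assumes "inj_on f S" "M \<in> perfect_matchings S"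
  shows "(`) f ` M \<in> perfect_matchings (f ` S)"
proof -
  have M: "partition_on S M" and two: "\<And>e. e \<in> M \<Longrightarrow> card e = 2"
    using assms by (auto simp: perfect_matchings_def)
  have "partition_on (f ` S) ((`) f ` M - {{}})"
    by (rule partition_on_inj_image[OF M assms(1)])
  moreover have "{} \<notin> (`) f ` M" using partition_onD3[OF M] by auto
  moreover have "card (f ` e) = 2" if "e \<in> M" for e
    using two[OF that] that partition_onD1[OF M] assms(1)
    by (subst card_image) (auto intro: inj_on_subset)
  ultimately show ?thesis by (auto simp: perfect_matchings_def)
qed

section \<open>Connected components of glued surfaces\<close>

lemma rtrancl_Un_Image:
  assumes "R \<subseteq> U \<times> U" "R' \<subseteq> V \<times> V" "U \<inter> V = {}" "u \<in> U"
  shows "(R \<union> R')\<^sup>* `` {u} = R\<^sup>* `` {u}"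
proof -
  \<comment> \<open>A path starting in \<open>U\<close> stays there: an endpoint in \<open>U\<close>
    forces the next edge into \<open>R\<close>.\<close>
  have "(u, v) \<in> R\<^sup>* \<and> v \<in> U" if "(u, v) \<in> (R \<union> R')\<^sup>*" for v
    using that by induction (use assms in \<open>auto intro: rtrancl_into_rtrancl\<close>)
  moreover have "R\<^sup>* \<subseteq> (R \<union> R')\<^sup>*" by (rule rtrancl_mono) auto
  ultimately show ?thesis by auto
qed

lemma rtrancl_Image_subset: "R \<subseteq> U \<times> U \<Longrightarrow> u \<in> U \<Longrightarrow> R\<^sup>* `` {u} \<subseteq> U"
  using rtrancl_Un_Image[of R U "{}" "{}" u] by (auto elim: rtranclE)

lemma card_quotient_Un:
  assumes "R \<subseteq> U \<times> U" "R' \<subseteq> V \<times> V" "U \<inter> V = {}" "finite U" "finite V"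
  shows "card ((U \<union> V) // (R \<union> R')\<^sup>*) = card (U // R\<^sup>*) + card (V // R'\<^sup>*)"
proof -
  have V: "(R \<union> R')\<^sup>* `` {v} = R'\<^sup>* `` {v}" if "v \<in> V" for v
    using rtrancl_Un_Image[of R' V R U v] assms that by (simp add: Un_commute Int_commute)
  have "(U \<union> V) // (R \<union> R')\<^sup>* = U // R\<^sup>* \<union> V // R'\<^sup>*"
    using rtrancl_Un_Image[OF assms(1-3)] V by (simp add: quotient_def)
  moreover have "U // R\<^sup>* \<inter> V // R'\<^sup>* = {}"
  proof -
    have "X \<noteq> {} \<and> X \<subseteq> U" if "X \<in> U // R\<^sup>*" for X
      using that rtrancl_Image_subset[OF assms(1)] by (force simp: quotient_def)
    moreover have "X \<subseteq> V" if "X \<in> V // R'\<^sup>*" for X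
      using that rtrancl_Image_subset[OF assms(2)] by (force simp: quotient_def)
    ultimately show ?thesis using assms(3) by blast
  qed
  moreover have "finite (U // R\<^sup>*)" "finite (V // R'\<^sup>*)"
    using assms by (simp_all add: quotient_def)
  ultimately show ?thesis by (simp add: card_Un_disjoint)
qed

lemma glued_subset:
  assumes "snd s \<in> perfect_matchings (U \<times> {..<P})"
  shows "glued s \<subseteq> U \<times> U"
  using assms by (auto simp: glued_def perfect_matchings_def partition_on_def)

lemma sym_glued: "sym (glued s)"
  unfolding glued_def sym_def by (auto simp: insert_commute)

text \<open>\<open>glued\<close> depends only on the matching, so label sets may be chosen freely
  when a gluing is split.\<close>

lemma glued_Un: "glued (U, M \<union> N) = glued (V, M) \<union> glued (W, N)"
  by (auto simp: glued_def)

lemma pi0_Un: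
  assumes "M \<in> perfect_matchings (U \<times> {..<P})" "N \<in> perfect_matchings (V \<times> {..<P})"
    "U \<inter> V = {}" "finite U" "finite V"
  shows "pi0 (U \<union> V, M \<union> N) = pi0 (U, M) + pi0 (V, N)"
  unfolding pi0_def fst_conv glued_Un[where V = U and W = V]
  using assms by (intro card_quotient_Un glued_subset) auto

lemma pi0_eq_0_iff: "finite (fst s) \<Longrightarrow> pi0 s = 0 \<longleftrightarrow> fst s = {}"
  by (auto simp: pi0_def quotient_def)

lemma pi0_le: "finite (fst s) \<Longrightarrow> pi0 s \<le> card (fst s)"
  unfolding pi0_def quotient_def UNION_singleton_eq_range by (rule card_image_le)

text \<open>Turns connectedness into reachability from one chosen polygon; symmetry of
  \<open>glued\<close> carries it over to all others.\<close>

lemma pi0_eq_1_iff: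
  assumes "M \<in> perfect_matchings (U \<times> {..<P})" "u \<in> U" "finite U"
  shows "pi0 (U, M) = 1 \<longleftrightarrow> (glued (U, M))\<^sup>* `` {u} = U"
proof
  assume "pi0 (U, M) = 1"
  then obtain X where X: "U // (glued (U, M))\<^sup>* = {X}" by (auto simp: pi0_def card_1_singleton_iff)
  then have "v \<in> (glued (U, M))\<^sup>* `` {u}" if "v \<in> U" for v
    using that assms(2) quotientI[of u U "(glued (U, M))\<^sup>*"] quotientI[of v U "(glued (U, M))\<^sup>*"]
    by auto
  then show "(glued (U, M))\<^sup>* `` {u} = U"
    using rtrancl_Image_subset[OF glued_subset[of "(U, M)" U P], of u] assms by auto
next
  assume *: "(glued (U, M))\<^sup>* `` {u} = U"
  have "(glued (U, M))\<^sup>* `` {v} = U" if "v \<in> U" for v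
  proof -
    have "(u, v) \<in> (glued (U, M))\<^sup>*" using * that by auto
    moreover from this have "(v, u) \<in> (glued (U, M))\<^sup>*"
      using sym_rtrancl[OF sym_glued] by (auto dest: symD)
    ultimately have "(glued (U, M))\<^sup>* `` {v} = (glued (U, M))\<^sup>* `` {u}" by (auto intro: rtrancl_trans)
    then show ?thesis using * by simp
  qed
  then have "U // (glued (U, M))\<^sup>* = {U}" using assms(2) by (auto simp: quotient_def)
  then show "pi0 (U, M) = 1" by (simp add: pi0_def)
qed

section \<open>Surfaces with a given number of components\<close>

text \<open>Only the matching is kept, so that surfaces on disjoint label sets combine by plain
  union.\<close>

definition gluings :: "nat \<Rightarrow> nat set \<Rightarrow> nat \<Rightarrow> (nat \<times> nat) set set set" where
  "gluings P U m = {M \<in> perfect_matchings (U \<times> {..<P}). pi0 (U, M) = m}"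

lemma finite_gluings: "finite U \<Longrightarrow> finite (gluings P U m)"
  by (simp add: gluings_def finite_perfect_matchings)

lemma surfaces_pi0_eq: "{s \<in> surfaces P U. pi0 s = m} = Pair U ` gluings P U m"
  by (auto simp: surfaces_def gluings_def)

text \<open>An injective relabelling maps the relation \<open>glued\<close> onto the new one and
  hence classes onto classes. This is why the counts depend only on the number of labels.\<close>

lemma gluings_image:
  assumes "inj_on f U" "M \<in> gluings P U m" "finite U"
  shows "(`) (map_prod f id) ` M \<in> gluings P (f ` U) m"
proof -
  let ?M' = "(`) (map_prod f id) ` M"
  let ?R = "glued (U, M)" and ?R' = "glued (f ` U, ?M')"
  have M: "M \<in> perfect_matchings (U \<times> {..<P})" and m: "pi0 (U, M) = m"
    using assms by (auto simp: gluings_def)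
  have inj: "inj_on (map_prod f id) (U \<times> {..<P})"
    using assms(1) by (intro map_prod_inj_on) auto
  have "map_prod f id ` (U \<times> {..<P}) = f ` U \<times> {..<P}" by (auto simp: image_iff)
  then have M': "?M' \<in> perfect_matchings (f ` U \<times> {..<P})"
    using perfect_matchings_image[OF inj M] by simp
  have RU: "?R \<subseteq> U \<times> U" using glued_subset[of "(U, M)"] M by simp
  have R': "?R' = map_prod f f ` ?R"
  proof (intro equalityI subsetI)
    fix p assume "p \<in> ?R'"
    then obtain u v a b where p: "p = (u, v)" and "{(u, a), (v, b)} \<in> ?M'"
      unfolding glued_def snd_conv by blast
    then obtain e where e: "e \<in> M" "map_prod f id ` e = {(u, a), (v, b)}" by (metis imageE)
    then have "(u, a) \<in> map_prod f id ` e" "(v, b) \<in> map_prod f id ` e" by simp_all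
    then obtain u' a' v' b' where uv: "(u', a') \<in> e" "(v', b') \<in> e" "f u' = u" "f v' = v"
      "a' = a" "b' = b" by auto
    \<comment> \<open>Injectivity of the map on sides recovers the block from its image.\<close>
    have "e = {(u', a'), (v', b')}"
    proof
      show "e \<subseteq> {(u', a'), (v', b')}"
      proof
        fix x assume x: "x \<in> e"
        then have "map_prod f id x \<in> {(u, a), (v, b)}" using e(2) by blast
        then have "map_prod f id x = map_prod f id (u', a') \<or> map_prod f id x = map_prod f id (v', b')"
          using uv by auto
        moreover have "e \<subseteq> U \<times> {..<P}" using e M by (auto simp: perfect_matchings_iff)
        then have "x \<in> U \<times> {..<P}" "(u', a') \<in> U \<times> {..<P}" "(v', b') \<in> U \<times> {..<P}"
          using x uv(1,2) by blast+
        ultimately show "x \<in> {(u', a'), (v', b')}" using inj_on_eq_iff[OF inj] by blast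
      qed
    qed (use uv in auto)
    then have "(u', v') \<in> ?R" using e by (auto simp: glued_def)
    then show "p \<in> map_prod f f ` ?R" using p uv by force
  next
    fix p assume "p \<in> map_prod f f ` ?R"
    then obtain u v a b where "p = (f u, f v)" "{(u, a), (v, b)} \<in> M" by (auto simp: glued_def)
    moreover from this have "map_prod f id ` {(u, a), (v, b)} \<in> ?M'" by (intro imageI)
    then have "{(f u, a), (f v, b)} \<in> ?M'" by simp
    ultimately show "p \<in> ?R'" unfolding glued_def snd_conv by blast
  qed
  have comp: "?R'\<^sup>* `` {f u} = f ` (?R\<^sup>* `` {u})" if u: "u \<in> U" for u
  proof (intro equalityI subsetI)
    fix y assume "y \<in> ?R'\<^sup>* `` {f u}"
    then have "(f u, y) \<in> ?R'\<^sup>*" by simp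
    \<comment> \<open>Paths are lifted back edge by edge; injectivity makes the start of each lifted
      edge agree with the end already reached.\<close>
    then have "\<exists>v\<in>U. y = f v \<and> (u, v) \<in> ?R\<^sup>*"
    proof induction
      case (step y z)
      then obtain v where v: "v \<in> U" "y = f v" "(u, v) \<in> ?R\<^sup>*" by auto
      from step(2) obtain v1 v2 where "(v1, v2) \<in> ?R" "y = f v1" "z = f v2" by (auto simp: R')
      moreover from this v RU have "v1 = v" using assms(1) by (auto dest: inj_onD)
      ultimately show ?case using v RU by (auto intro: rtrancl_into_rtrancl)
    qed (use u in auto)
    then show "y \<in> f ` (?R\<^sup>* `` {u})" by auto
  next
    fix y assume "y \<in> f ` (?R\<^sup>* `` {u})"
    then obtain v where v: "y = f v" "(u, v) \<in> ?R\<^sup>*" by auto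
    from v(2) have "(f u, f v) \<in> ?R'\<^sup>*"
    proof induction
      case (step y z)
      have "(f y, f z) \<in> ?R'" using imageI[OF step(2), of "map_prod f f"] by (simp only: R' map_prod_simp)
      with step.IH show ?case by (rule rtrancl_into_rtrancl)
    qed simp
    then show "y \<in> ?R'\<^sup>* `` {f u}" using v by simp
  qed
  have "f ` U // ?R'\<^sup>* = (`) f ` (U // ?R\<^sup>*)"
    using comp by (auto simp: quotient_def)
  moreover have "inj_on ((`) f) (U // ?R\<^sup>*)"
  proof (rule inj_on_subset[OF inj_on_image_Pow[OF assms(1)]])
    show "U // ?R\<^sup>* \<subseteq> Pow U" using rtrancl_Image_subset[OF RU] by (auto simp: quotient_def)
  qed
  ultimately have "pi0 (f ` U, ?M') = m"
    using m by (simp add: pi0_def card_image)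
  then show ?thesis using M' by (simp add: gluings_def)
qed

lemma card_gluings_le:
  assumes "finite U" "finite V" "card U = card V"
  shows "card (gluings P U m) \<le> card (gluings P V m)"
proof -
  obtain f where f: "bij_betw f U V" using assms by (metis finite_same_card_bij)
  then have inj: "inj_on f U" and V: "V = f ` U" by (auto simp: bij_betw_def)
  have "inj_on (map_prod f id) (U \<times> {..<P})"
    using inj by (intro map_prod_inj_on) auto
  then have "inj_on (\<lambda>M. (`) (map_prod f id) ` M) (Pow (Pow (U \<times> {..<P})))"
    by (intro inj_on_image_Pow)
  then have "inj_on (\<lambda>M. (`) (map_prod f id) ` M) (gluings P U m)"
    by (rule inj_on_subset) (auto simp: gluings_def perfect_matchings_def partition_on_def)
  then show ?thesis
    using gluings_image[OF inj _ assms(1)] assms(2) unfolding V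
    by (intro card_inj_on_le[where f = "\<lambda>M. (`) (map_prod f id) ` M"]) (auto intro: finite_gluings)
qed

lemma card_gluings_cong:
  "finite U \<Longrightarrow> finite V \<Longrightarrow> card U = card V \<Longrightarrow> card (gluings P U m) = card (gluings P V m)"
  by (intro antisym card_gluings_le) auto

lemma gluings_Un:
  assumes "M \<in> gluings P V k" "N \<in> gluings P W m" "V \<inter> W = {}" "finite V" "finite W"
  shows "M \<union> N \<in> gluings P (V \<union> W) (k + m)"
proof -
  have "V \<times> {..<P} \<inter> W \<times> {..<P} = {}" using assms(3) by auto
  then have "M \<union> N \<in> perfect_matchings ((V \<union> W) \<times> {..<P})"
    using perfect_matchings_Un[of M "V \<times> {..<P}" N "W \<times> {..<P}"] assms
    by (simp add: gluings_def Sigma_Un_distrib1)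
  then show ?thesis using pi0_Un[of M V P N W] assms by (simp add: gluings_def)
qed

text \<open>\<open>V\<close> is the label set of the component of \<open>u\<close>. The inverse map
  computes this component and restricts the gluing to it and to its complement; singling out
  \<open>u\<close> makes the decomposition unique.\<close>

lemma gluings_component_decomposition:
  assumes "finite U" "u \<in> U"
  shows "bij_betw (\<lambda>(V, M, N). M \<union> N)
           (SIGMA V:{V. u \<in> V \<and> V \<subseteq> U}. gluings P V 1 \<times> gluings P (U - V) m) (gluings P U (Suc m))"
proof -
  let ?D = "SIGMA V:{V. u \<in> V \<and> V \<subseteq> U}. gluings P V 1 \<times> gluings P (U - V) m"
  define comp where "comp = (\<lambda>M. (glued (U, M))\<^sup>* `` {u})"
  define restr :: "(nat \<times> nat) set set \<Rightarrow> nat set \<Rightarrow> (nat \<times> nat) set set"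
    where "restr = (\<lambda>M V. {e \<in> M. e \<subseteq> V \<times> {..<P}})"
  let ?g = "\<lambda>M. (comp M, restr M (comp M), restr M (U - comp M))"
  have left: "M \<union> N \<in> gluings P U (Suc m) \<and> ?g (M \<union> N) = (V, M, N)"
    if V: "u \<in> V" "V \<subseteq> U" and M: "M \<in> gluings P V 1" and N: "N \<in> gluings P (U - V) m" for V M N
  proof -
    have fin: "finite V" "finite (U - V)" using V assms finite_subset by auto
    have UV: "V \<union> (U - V) = U" "V \<inter> (U - V) = {}" using V by auto
    have PM: "M \<in> perfect_matchings (V \<times> {..<P})" and PN: "N \<in> perfect_matchings ((U - V) \<times> {..<P})"
      using M N by (auto simp: gluings_def)
    have "M \<union> N \<in> gluings P (V \<union> (U - V)) (1 + m)"
      using M N UV fin by (intro gluings_Un) auto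
    then have "M \<union> N \<in> gluings P U (Suc m)" using UV by simp
    moreover have "comp (M \<union> N) = V"
    proof -
      have "comp (M \<union> N) = (glued (V, M))\<^sup>* `` {u}"
        unfolding comp_def glued_Un[where V = V and W = "U - V"]
        by (rule rtrancl_Un_Image[OF glued_subset glued_subset UV(2) V(1)]) (use PM PN in auto)
      then show ?thesis using pi0_eq_1_iff[OF PM V(1) fin(1)] M by (simp add: gluings_def)
    qed
    moreover have "restr (M \<union> N) V = M"
      unfolding restr_def by (rule perfect_matchings_Un_restrict[OF PM PN]) auto
    moreover have "restr (M \<union> N) (U - V) = N"
      unfolding restr_def by (subst Un_commute, rule perfect_matchings_Un_restrict[OF PN PM]) auto
    ultimately show ?thesis by simp
  qed
  have right: "?g M \<in> ?D \<and> restr M (comp M) \<union> restr M (U - comp M) = M"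
    if M: "M \<in> gluings P U (Suc m)" for M
  proof -
    have PM: "M \<in> perfect_matchings (U \<times> {..<P})" and m: "pi0 (U, M) = Suc m"
      using M by (auto simp: gluings_def)
    let ?V = "comp M"
    have gU: "glued (U, M) \<subseteq> U \<times> U" using glued_subset[of "(U, M)"] PM by simp
    have V: "u \<in> ?V" "?V \<subseteq> U"
      using rtrancl_Image_subset[OF gU assms(2)] by (auto simp: comp_def)
    have fin: "finite ?V" "finite (U - ?V)" using V assms finite_subset by auto
    have UV: "?V \<union> (U - ?V) = U" using V by auto
    have step: "v' \<in> ?V" if "(v, v') \<in> glued (U, M)" "v \<in> ?V" for v v'
      using that by (auto simp: comp_def intro: rtrancl_into_rtrancl)
    \<comment> \<open>The sides in a block belong to glued polygons, which lie together inside or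
      together outside the component of \<open>u\<close>.\<close>
    have split: "e \<subseteq> ?V \<times> {..<P} \<or> e \<subseteq> (U - ?V) \<times> {..<P}" if e: "e \<in> M" for e
    proof -
      have "card e = 2" and eU: "e \<subseteq> U \<times> {..<P}" using PM e by (auto simp: perfect_matchings_iff)
      then obtain v a v' b where eq: "e = {(v, a), (v', b)}" by (auto simp: card_2_iff)
      then have "(v, v') \<in> glued (U, M)" using e unfolding glued_def snd_conv by blast
      moreover from this have "(v', v) \<in> glued (U, M)" using sym_glued by (auto dest: symD)
      ultimately have "v \<in> ?V \<longleftrightarrow> v' \<in> ?V" using step by blast
      then show ?thesis using eq eU by auto
    qed
    have PU: "U \<times> {..<P} = ?V \<times> {..<P} \<union> (U - ?V) \<times> {..<P}" using UV by auto
    have P1: "restr M ?V \<in> perfect_matchings (?V \<times> {..<P})"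
      unfolding restr_def using PM split unfolding PU
      by (intro perfect_matchings_restrict) auto
    have P2: "restr M (U - ?V) \<in> perfect_matchings ((U - ?V) \<times> {..<P})"
      unfolding restr_def using PM split unfolding PU Un_commute[of "?V \<times> {..<P}"]
      by (intro perfect_matchings_restrict) auto
    have un: "restr M ?V \<union> restr M (U - ?V) = M" using split by (auto simp: restr_def)
    have "glued (U, M) = glued (?V, restr M ?V) \<union> glued (U - ?V, restr M (U - ?V))"
      using glued_Un[of U "restr M ?V" "restr M (U - ?V)" ?V "U - ?V"] unfolding un .
    then have "?V = (glued (?V, restr M ?V) \<union> glued (U - ?V, restr M (U - ?V)))\<^sup>* `` {u}"
      by (metis comp_def)
    also have "\<dots> = (glued (?V, restr M ?V))\<^sup>* `` {u}"
      by (rule rtrancl_Un_Image[OF glued_subset glued_subset _ V(1)]) (use P1 P2 in auto)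
    finally have one: "pi0 (?V, restr M ?V) = 1"
      using pi0_eq_1_iff[OF P1 V(1) fin(1)] by simp
    have "Suc m = pi0 (?V, restr M ?V) + pi0 (U - ?V, restr M (U - ?V))"
      using pi0_Un[OF P1 P2 _ fin] m unfolding un UV by simp
    with one P1 P2 V un show ?thesis by (auto simp: gluings_def)
  qed
  show ?thesis
  proof (rule bij_betw_byWitness[where f' = ?g])
    show "\<forall>x\<in>?D. ?g ((\<lambda>(V, M, N). M \<union> N) x) = x"
    proof
      fix x assume "x \<in> ?D"
      moreover obtain V M N where x: "x = (V, M, N)" by (cases x)
      ultimately have "?g (M \<union> N) = (V, M, N)" using left[of V M N] by blast
      then show "?g ((\<lambda>(V, M, N). M \<union> N) x) = x" unfolding x prod.case .
    qed
    show "\<forall>M\<in>gluings P U (Suc m). (\<lambda>(V, M, N). M \<union> N) (?g M) = M" using right by auto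
    show "(\<lambda>(V, M, N). M \<union> N) ` ?D \<subseteq> gluings P U (Suc m)" using left by auto
    show "?g ` gluings P U (Suc m) \<subseteq> ?D" using right by blast
  qed
qed

lemma sum_Pow_card:
  fixes g :: "nat \<Rightarrow> 'a::comm_semiring_1"
  assumes "finite S"
  shows "(\<Sum>W\<in>Pow S. g (card W)) = (\<Sum>j\<le>card S. of_nat (card S choose j) * g j)"
proof -
  have "(\<Sum>W\<in>Pow S. g (card W)) = (\<Sum>j\<le>card S. \<Sum>W\<in>{W\<in>Pow S. card W = j}. g (card W))"
    using assms by (intro sum.group[symmetric]) (auto intro: card_mono)
  also have "\<dots> = (\<Sum>j\<le>card S. of_nat (card S choose j) * g j)"
    using n_subsets[OF assms] by (intro sum.cong) auto
  finally show ?thesis .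
qed

definition num_gluings :: "nat \<Rightarrow> nat \<Rightarrow> nat \<Rightarrow> nat" where
  "num_gluings P n m = card (gluings P {1..n} m)"

lemma card_gluings: "finite U \<Longrightarrow> card (gluings P U m) = num_gluings P (card U) m"
  unfolding num_gluings_def by (rule card_gluings_cong) auto

text \<open>With labels \<open>{..n}\<close> and distinguished polygon \<open>0\<close>, the
  binomial coefficient chooses the \<open>j\<close> other polygons of its component among
  \<open>{1..n}\<close>.\<close>

lemma num_gluings_Suc:
  "num_gluings P (Suc n) (Suc m) =
     (\<Sum>j\<le>n. (n choose j) * (num_gluings P (Suc j) 1 * num_gluings P (n - j) m))"
proof -
  let ?U = "{..n}" and ?S = "{1..n}"
  have fin: "finite V" if "V \<subseteq> ?U" for V using that finite_subset by blast
  have "num_gluings P (Suc n) (Suc m) = card (gluings P ?U (Suc m))"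
    by (simp add: card_gluings)
  also have "\<dots> = card (SIGMA V:{V. 0 \<in> V \<and> V \<subseteq> ?U}. gluings P V 1 \<times> gluings P (?U - V) m)"
    by (rule bij_betw_same_card[symmetric], rule gluings_component_decomposition) auto
  also have "\<dots> = (\<Sum>V | 0 \<in> V \<and> V \<subseteq> ?U. card (gluings P V 1 \<times> gluings P (?U - V) m))"
    by (rule card_SigmaI) (auto intro: finite_gluings fin)
  also have "\<dots> = (\<Sum>W\<in>Pow ?S. card (gluings P (insert 0 W) 1 \<times> gluings P (?U - insert 0 W) m))"
    by (rule sum.reindex_bij_witness[of _ "insert 0" "\<lambda>V. V - {0}"])
      (auto simp: insert_absorb Suc_le_eq intro: Suc_leI)
  also have "\<dots> = (\<Sum>W\<in>Pow ?S. num_gluings P (Suc (card W)) 1 * num_gluings P (n - card W) m)"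
  proof (rule sum.cong)
    fix W assume "W \<in> Pow ?S"
    then have W: "W \<subseteq> ?S" "finite W" "0 \<notin> W" "insert 0 W \<subseteq> ?U"
      using finite_subset[of W ?S] by auto
    then have "card (?U - insert 0 W) = n - card W" by (simp add: card_Diff_subset)
    with W show "card (gluings P (insert 0 W) 1 \<times> gluings P (?U - insert 0 W) m)
        = num_gluings P (Suc (card W)) 1 * num_gluings P (n - card W) m"
      by (simp add: card_cartesian_product card_gluings)
  qed simp
  also have "\<dots> = (\<Sum>j\<le>n. (n choose j) * (num_gluings P (Suc j) 1 * num_gluings P (n - j) m))"
    by (subst sum_Pow_card) auto
  finally show ?thesis .
qed

lemma num_gluings_0_left: "num_gluings P 0 m = (if m = 0 then 1 else 0)"
  by (auto simp: num_gluings_def gluings_def pi0_def quotient_def)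

lemma num_gluings_0_right: "num_gluings P n 0 = (if n = 0 then 1 else 0)"
proof (cases "n = 0")
  case False
  then have "gluings P {1..n} 0 = {}" by (auto simp: gluings_def pi0_eq_0_iff)
  then show ?thesis using False by (simp add: num_gluings_def)
qed (simp add: num_gluings_0_left)

lemma num_gluings_eq_0: "n < m \<Longrightarrow> num_gluings P n m = 0"
proof -
  assume "n < m"
  have "M \<notin> gluings P {1..n} m" for M
    using pi0_le[of "({1..n}, M)"] \<open>n < m\<close> by (simp add: gluings_def)
  then have "gluings P {1..n} m = {}" by blast
  then show ?thesis by (simp add: num_gluings_def)
qed

text \<open>Grouping by the number of components; \<open>x = 1\<close> gives the plain and
  \<open>x = - 1\<close> the signed counts.\<close>

lemma sum_perfect_matchings_pi0:
  fixes x :: "'a::comm_semiring_1"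
  assumes "finite U"
  shows "(\<Sum>M\<in>perfect_matchings (U \<times> {..<P}). x ^ pi0 (U, M))
           = (\<Sum>m\<le>card U. of_nat (num_gluings P (card U) m) * x ^ m)"
proof -
  have "(\<Sum>M\<in>perfect_matchings (U \<times> {..<P}). x ^ pi0 (U, M))
      = (\<Sum>m\<le>card U. \<Sum>M\<in>gluings P U m. x ^ pi0 (U, M))"
    using assms pi0_le[of "(U, _)"] unfolding gluings_def
    by (intro sum.group[symmetric] finite_perfect_matchings) auto
  also have "\<dots> = (\<Sum>m\<le>card U. of_nat (num_gluings P (card U) m) * x ^ m)"
    using assms by (intro sum.cong) (auto simp: gluings_def simp flip: card_gluings)
  finally show ?thesis .
qed

section \<open>Exponential generating functions\<close>

definition components_fps :: "nat \<Rightarrow> nat \<Rightarrow> real fps" where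
  "components_fps P m = Abs_fps (\<lambda>n. real (num_gluings P n m) / fact n)"

text \<open>This is the exponential of \<open>x\<close> times \<open>components_fps P 1\<close>. The
  inner sum stops at \<open>n\<close> because \<open>n\<close> polygons form at most
  \<open>n\<close> components.\<close>

definition weighted_fps :: "nat \<Rightarrow> real \<Rightarrow> real fps" where
  "weighted_fps P x = Abs_fps (\<lambda>n. (\<Sum>m\<le>n. real (num_gluings P n m) * x ^ m) / fact n)"

lemma components_fps_0: "components_fps P 0 = 1"
  by (rule fps_ext) (simp add: components_fps_def num_gluings_0_right)

text \<open>Differentiating an exponential generating function marks one polygon, and
  \<open>num_gluings_Suc\<close> splits off its component.\<close>

lemma fps_deriv_components_Suc:
  "fps_deriv (components_fps P (Suc m)) = fps_deriv (components_fps P 1) * components_fps P m"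
proof (rule fps_ext)
  fix n
  have deriv: "fps_deriv (components_fps P k) $ n = real (num_gluings P (Suc n) k) / fact n" for k n
    by (simp add: components_fps_def field_simps del: of_nat_Suc)
  have "fps_deriv (components_fps P (Suc m)) $ n
      = (\<Sum>j\<le>n. real (n choose j) * (real (num_gluings P (Suc j) 1) * real (num_gluings P (n - j) m)) / fact n)"
    unfolding deriv num_gluings_Suc by (simp add: sum_divide_distrib)
  also have "\<dots> = (\<Sum>j\<le>n. (real (num_gluings P (Suc j) 1) / fact j) * (real (num_gluings P (n - j) m) / fact (n - j)))"
    by (intro sum.cong) (auto simp: binomial_fact)
  finally show "fps_deriv (components_fps P (Suc m)) $ n
      = (fps_deriv (components_fps P 1) * components_fps P m) $ n"
    unfolding fps_mult_nth deriv atMost_atLeast0[symmetric] by (simp add: components_fps_def)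
qed

text \<open>A common bound \<open>N\<close> for all coefficients up to index \<open>N\<close> makes
  it possible to exchange sums.\<close>

lemma weighted_fps_nth: "n \<le> N \<Longrightarrow> weighted_fps P x $ n = (\<Sum>m\<le>N. x ^ m * components_fps P m $ n)"
proof -
  assume "n \<le> N"
  then have "(\<Sum>m\<le>N. x ^ m * components_fps P m $ n) = (\<Sum>m\<le>n. x ^ m * components_fps P m $ n)"
    by (intro sum.mono_neutral_right) (auto simp: components_fps_def num_gluings_eq_0)
  then show ?thesis
    by (simp add: weighted_fps_def components_fps_def sum_divide_distrib mult.commute)
qed

lemma fps_deriv_weighted:
  "fps_deriv (weighted_fps P x) = fps_const x * fps_deriv (components_fps P 1) * weighted_fps P x"
proof (rule fps_ext)
  fix n
  define L where "L = fps_deriv (components_fps P 1)"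
  have "fps_deriv (weighted_fps P x) $ n = (\<Sum>m\<le>Suc n. x ^ m * fps_deriv (components_fps P m) $ n)"
    using weighted_fps_nth[of "Suc n" "Suc n" P x]
    by (simp add: sum_distrib_left algebra_simps del: sum.atMost_Suc)
  \<comment> \<open>The term \<open>m = 0\<close> is constant and drops out; each other one splits
    off a factor \<open>L\<close>.\<close>
  also have "\<dots> = (\<Sum>m\<le>n. x ^ Suc m * (L * components_fps P m) $ n)"
    unfolding sum.atMost_Suc_shift components_fps_0 fps_deriv_components_Suc L_def by simp
  also have "\<dots> = (\<Sum>m\<le>n. \<Sum>i=0..n. x * (L $ i * (x ^ m * components_fps P m $ (n - i))))"
    by (simp add: fps_mult_nth sum_distrib_left algebra_simps)
  also have "\<dots> = (\<Sum>i=0..n. x * (L $ i * (\<Sum>m\<le>n. x ^ m * components_fps P m $ (n - i))))"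
    by (subst sum.swap) (simp add: sum_distrib_left)
  also have "\<dots> = (\<Sum>i=0..n. x * (L $ i * weighted_fps P x $ (n - i)))"
    using weighted_fps_nth[of _ n P x] by (intro sum.cong refl) simp
  also have "\<dots> = (fps_const x * L * weighted_fps P x) $ n"
    unfolding mult.assoc fps_mult_left_const_nth by (simp add: fps_mult_nth sum_distrib_left)
  finally show "fps_deriv (weighted_fps P x) $ n
      = (fps_const x * fps_deriv (components_fps P 1) * weighted_fps P x) $ n" unfolding L_def .
qed

text \<open>The factors solve linear differential equations with opposite coefficients, so their
  product is constant.\<close>

lemma weighted_fps_inverse: "weighted_fps P 1 * weighted_fps P (- 1) = 1"
proof -
  have "fps_deriv (weighted_fps P 1 * weighted_fps P (- 1)) = 0"
    by (simp add: fps_deriv_weighted algebra_simps flip: fps_const_neg)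
  then have "weighted_fps P 1 * weighted_fps P (- 1)
      = fps_const ((weighted_fps P 1 * weighted_fps P (- 1)) $ 0)"
    by (simp only: fps_deriv_eq_0_iff)
  also have "(weighted_fps P 1 * weighted_fps P (- 1)) $ 0 = 1"
    by (simp add: weighted_fps_def num_gluings_0_left)
  finally show ?thesis by simp
qed

text \<open>Inserting the product of the two weighted series, which is \<open>1\<close>, replaces
  the derivative of the connected series by that of the series of all surfaces, whose coefficients
  are explicit.\<close>

lemma fps_euler_components_Suc:
  "fps_euler (components_fps P (Suc m))
     = fps_euler (weighted_fps P 1) * (weighted_fps P (- 1) * components_fps P m)"
proof -
  have "fps_deriv (components_fps P (Suc m)) = fps_deriv (components_fps P 1)
      * (weighted_fps P 1 * weighted_fps P (- 1)) * components_fps P m"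
    unfolding weighted_fps_inverse mult_1_right by (rule fps_deriv_components_Suc)
  also have "\<dots> = fps_deriv (weighted_fps P 1) * (weighted_fps P (- 1) * components_fps P m)"
    unfolding fps_deriv_weighted by (simp add: mult.assoc)
  finally show ?thesis unfolding fps_euler_conv_deriv by (simp only: mult.assoc)
qed

lemma weighted_fps_1_nth: "weighted_fps P 1 $ n = real (card (surfaces P {1..n})) / fact n"
proof -
  have "card (surfaces P {1..n}) = card (perfect_matchings ({1..n} \<times> {..<P}))"
    by (simp add: surfaces_def card_cartesian_product)
  then show ?thesis
    using sum_perfect_matchings_pi0[of "{1..n}" "1::real" P] by (simp add: weighted_fps_def)
qed

section \<open>Counting surfaces, and the coefficients \<open>dcoeff\<close> as a
  convolution\<close>

lemma card_surfaces:
  "finite U \<Longrightarrow> card (surfaces P U)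
     = (if even (P * card U) then dfact (int P * int (card U) - 1) else 0)"
  by (simp add: surfaces_def card_cartesian_product card_perfect_matchings mult.commute)

text \<open>Pairs are sorted by the label set \<open>U\<close> of the first surface, with
  \<open>i = card U\<close>; since surfaces carry their labels, the families are disjoint.
  \<open>Q\<close> will be one of the two parities.\<close>

lemma dcoeff_set_card:
  "card {(s', s''). (\<exists>i\<le>k. (s', s'') \<in> surface_pairs P i (k - i)) \<and> pi0 s' = m \<and> Q (pi0 s'')}
     = (\<Sum>U\<in>Pow {1..k}. card {s \<in> surfaces P U. pi0 s = m} * card {s \<in> surfaces P ({1..k} - U). Q (pi0 s)})"
  (is "card ?S = _")
proof -
  let ?B = "\<lambda>U. {s \<in> surfaces P U. pi0 s = m} \<times> {s \<in> surfaces P ({1..k} - U). Q (pi0 s)}"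
  have "?S = (\<Union>U\<in>Pow {1..k}. ?B U)"
  proof (intro equalityI subsetI)
    fix p assume "p \<in> ?S"
    then obtain s' s'' i where p: "p = (s', s'')" and i: "i \<le> k"
      and s: "(s', s'') \<in> surface_pairs P i (k - i)" and Q: "pi0 s' = m" "Q (pi0 s'')" by auto
    from s i obtain U V where UV: "U \<union> V = {1..k}" "U \<inter> V = {}"
      and sUV: "s' \<in> surfaces P U" "s'' \<in> surfaces P V"
      by (auto simp: surface_pairs_def)
    from UV have "V = {1..k} - U" "U \<in> Pow {1..k}" by auto
    then show "p \<in> (\<Union>U\<in>Pow {1..k}. ?B U)" using p Q sUV by auto
  next
    fix p assume "p \<in> (\<Union>U\<in>Pow {1..k}. ?B U)"
    then obtain s' s'' U where p: "p = (s', s'')" and U: "U \<subseteq> {1..k}"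
      and s: "s' \<in> surfaces P U" "s'' \<in> surfaces P ({1..k} - U)" and Q: "pi0 s' = m" "Q (pi0 s'')"
      by auto
    have "finite U" using U finite_subset by blast
    then have c: "card U \<le> k" "card ({1..k} - U) = k - card U"
      using card_mono[OF _ U] U by (auto simp: card_Diff_subset)
    then have "(s', s'') \<in> surface_pairs P (card U) (k - card U)"
      unfolding surface_pairs_def using s U by (intro UN_I[of "(U, {1..k} - U)"]) auto
    then show "p \<in> ?S" using p Q c by auto
  qed
  moreover have "card (\<Union>U\<in>Pow {1..k}. ?B U) = (\<Sum>U\<in>Pow {1..k}. card (?B U))"
  proof (rule card_UN_disjoint)
    have "finite (surfaces P U)" if "U \<subseteq> {1..k}" for U
      using that finite_subset[of U "{1..k}"] by (auto simp: surfaces_def intro!: finite_perfect_matchings)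
    then show "\<forall>U\<in>Pow {1..k}. finite (?B U)" by auto
    show "\<forall>U\<in>Pow {1..k}. \<forall>V\<in>Pow {1..k}. U \<noteq> V \<longrightarrow> ?B U \<inter> ?B V = {}"
      by (auto simp: surfaces_def)
  qed simp
  ultimately show ?thesis by (simp add: card_cartesian_product)
qed

lemma card_even_minus_card_odd:
  assumes "finite S"
  shows "int (card {s \<in> S. even (f s)}) - int (card {s \<in> S. odd (f s)}) = (\<Sum>s\<in>S. (- 1) ^ f s)"
proof -
  have "(\<Sum>s\<in>S. (- 1) ^ f s) = (\<Sum>s\<in>{s \<in> S. even (f s)}. (- 1) ^ f s) + (\<Sum>s\<in>{s \<in> S. odd (f s)}. (- 1 :: int) ^ f s)"
    using assms by (subst sum.union_disjoint[symmetric]) (auto intro!: sum.cong)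
  then show ?thesis by simp
qed

text \<open>The difference of the parity counts is a sum of signs \<open>(- 1) ^ pi0\<close>, and
  grouping by \<open>card U\<close> gives the binomial convolution of exponential generating
  functions.\<close>

lemma dcoeff_eq:
  assumes "m \<ge> 1"
  shows "real_of_int (dcoeff P k m) = fact k * (weighted_fps P (- 1) * components_fps P (m - 1)) $ k"
proof -
  define e :: "nat \<Rightarrow> int" where "e = (\<lambda>n. \<Sum>j\<le>n. int (num_gluings P n j) * (- 1) ^ j)"
  have fin: "finite U" if "U \<subseteq> {1..k}" for U using that finite_subset by blast
  have sum_e: "int (card {s \<in> surfaces P U. even (pi0 s)}) - int (card {s \<in> surfaces P U. odd (pi0 s)})
      = e (card U)" if "finite U" for U
  proof -
    have "finite (surfaces P U)" using that by (auto simp: surfaces_def intro!: finite_perfect_matchings)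
    then have "int (card {s \<in> surfaces P U. even (pi0 s)}) - int (card {s \<in> surfaces P U. odd (pi0 s)})
        = (\<Sum>s\<in>surfaces P U. (- 1) ^ pi0 s)" by (rule card_even_minus_card_odd)
    also have "\<dots> = (\<Sum>M\<in>perfect_matchings (U \<times> {..<P}). (- 1) ^ pi0 (U, M))"
      unfolding surfaces_def by (rule sum.reindex_bij_witness[of _ "Pair U" snd]) auto
    finally show ?thesis using sum_perfect_matchings_pi0[OF that, of "-1::int" P] by (simp add: e_def)
  qed
  have "dcoeff P k m = (\<Sum>U\<in>Pow {1..k}. int (card {s \<in> surfaces P U. pi0 s = m - 1}) *
      (int (card {s \<in> surfaces P ({1..k} - U). even (pi0 s)}) - int (card {s \<in> surfaces P ({1..k} - U). odd (pi0 s)})))"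
    using dcoeff_set_card[of k P "m - 1" even] dcoeff_set_card[of k P "m - 1" odd]
    unfolding dcoeff_def by (simp add: sum_subtractf right_diff_distrib)
  also have "\<dots> = (\<Sum>U\<in>Pow {1..k}. int (num_gluings P (card U) (m - 1)) * e (k - card U))"
    by (intro sum.cong refl)
      (auto simp: sum_e fin surfaces_pi0_eq card_image card_gluings card_Diff_subset inj_on_def)
  also have "\<dots> = (\<Sum>j\<le>k. int (k choose j) * (int (num_gluings P j (m - 1)) * e (k - j)))"
    by (subst sum_Pow_card) auto
  finally have "real_of_int (dcoeff P k m)
      = (\<Sum>j\<le>k. real (k choose j) * (real (num_gluings P j (m - 1)) * real_of_int (e (k - j))))"
    by simp
  also have "\<dots> = fact k * (\<Sum>j\<le>k. components_fps P (m - 1) $ j * weighted_fps P (- 1) $ (k - j))"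
    unfolding sum_distrib_left
    by (intro sum.cong) (auto simp: components_fps_def weighted_fps_def e_def binomial_fact)
  finally show ?thesis unfolding mult.commute[of "weighted_fps P (- 1)"] fps_mult_nth atMost_atLeast0 .
qed

section \<open>The expansion\<close>

text \<open>For odd \<open>P\<close> the coefficients of odd index vanish, so the growth hypotheses can only hold for the
  series of the coefficients of even index.\<close>

definition fps_multisection :: "nat \<Rightarrow> 'a::comm_ring_1 fps \<Rightarrow> 'a fps" where
  "fps_multisection q F = Abs_fps (\<lambda>n. F $ (q * n))"

lemma fps_multisection_nth [simp]: "fps_multisection q F $ n = F $ (q * n)"
  by (simp add: fps_multisection_def)

lemma fps_multisection_1 [simp]: "q > 0 \<Longrightarrow> fps_multisection q 1 = 1"
  by (rule fps_ext) simp

text \<open>If the first index is a multiple of \<open>q\<close>, so is the second one; hence the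
  support of one factor suffices.\<close>

lemma fps_multisection_mult:
  assumes "q > 0" and F: "\<And>n. \<not> q dvd n \<Longrightarrow> F $ n = 0"
  shows "fps_multisection q (F * G) = fps_multisection q F * fps_multisection q G"
proof (rule fps_ext)
  fix n
  have "(F * G) $ (q * n) = (\<Sum>i\<in>(*) q ` {0..n}. F $ i * G $ (q * n - i))"
    unfolding fps_mult_nth
  proof (rule sum.mono_neutral_right)
    show "\<forall>i\<in>{0..q * n} - (*) q ` {0..n}. F $ i * G $ (q * n - i) = 0"
    proof
      fix i assume i: "i \<in> {0..q * n} - (*) q ` {0..n}"
      have "\<not> q dvd i"
      proof
        assume "q dvd i"
        then obtain j where "i = q * j" by (elim dvdE)
        then show False using i assms(1) by auto
      qed
      then show "F $ i * G $ (q * n - i) = 0" using F by simp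
    qed
  qed auto
  also have "\<dots> = (\<Sum>i=0..n. F $ (q * i) * G $ (q * (n - i)))"
    using assms(1) by (subst sum.reindex) (auto simp: inj_on_def right_diff_distrib')
  finally show "fps_multisection q (F * G) $ n = (fps_multisection q F * fps_multisection q G) $ n"
    by (simp add: fps_mult_nth)
qed

lemma fps_multisection_euler:
  "fps_multisection q (fps_euler F) = of_nat q * fps_euler (fps_multisection q F)"
  by (rule fps_ext) (simp add: fps_of_nat[symmetric] mult.assoc)

section \<open>Growth of the series of all surfaces\<close>

lemma dfact_add:
  "dfact (int (N + 2 * h) - 1) = (\<Prod>i<h. N + 2 * i + 1) * dfact (int N - 1)"
proof (induction h)
  case (Suc h)
  have "dfact (int (N + 2 * Suc h) - 1) = (N + 2 * h + 1) * dfact (int (N + 2 * h) - 1)"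
    by (subst dfact_rec) (auto simp: nat_diff_distrib nat_add_distrib algebra_simps)
  then show ?case unfolding Suc.IH prod.lessThan_Suc by (simp only: mult.assoc mult.commute mult.left_commute)
qed simp

text \<open>The factors of a ratio of double factorials are matched with those of a ratio of factorials in
  such a way that every quotient is nondecreasing in \<open>j\<close>, at least \<open>1\<close>, and the first one grows
  linearly.\<close>

lemma superexponential_growth_linear_fractions:
  fixes A :: "real fps" and d e :: "nat \<Rightarrow> nat"
  assumes A_0: "A $ 0 = 1"
    and A_Suc: "\<And>j. A $ Suc j = (\<Prod>i<h. real (2 * h * j + 2 * i + 1) / real (d i * j + e i)) * A $ j"
    and "h \<ge> 1" "d 0 = 0" "e 0 = 1"
    and de: "\<And>i. i < h \<Longrightarrow> 0 < e i \<and> d i \<le> 2 * h \<and> e i \<le> 2 * i + 1 \<and> (2 * i + 1) * d i \<le> 2 * h * e i"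
  shows "superexponential_growth A (\<lambda>j. \<Prod>i<h. real (2 * h * j + 2 * i + 1) / real (d i * j + e i))"
    (is "superexponential_growth A (\<lambda>j. \<Prod>i<h. ?f i j)")
proof
  show "mono (\<lambda>j. \<Prod>i<h. ?f i j)"
  proof (intro monoI prod_mono conjI)
    fix j k i :: nat assume jk: "j \<le> k" and i: "i \<in> {..<h}"
    obtain t where k: "k = j + t" using jk le_Suc_ex by blast
    \<comment> \<open>With \<open>k = j + t\<close>, cross-multiplying the monotonicity claim leaves
      exactly this inequality.\<close>
    have "t * ((2 * i + 1) * d i) \<le> t * (2 * h * e i)" using de i by (intro mult_left_mono) auto
    then have "(2 * h * j + 2 * i + 1) * (d i * k + e i) \<le> (2 * h * k + 2 * i + 1) * (d i * j + e i)"
      unfolding k by (simp add: algebra_simps)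
    then have "real (2 * h * j + 2 * i + 1) * real (d i * k + e i)
        \<le> real (2 * h * k + 2 * i + 1) * real (d i * j + e i)"
      by (metis of_nat_le_iff of_nat_mult)
    moreover have "d i * k + e i > 0" "d i * j + e i > 0" using de i by auto
    then have "real (d i * k + e i) > 0" "real (d i * j + e i) > 0" by (simp_all only: of_nat_0_less_iff)
    ultimately show "?f i j \<le> ?f i k" 
      by (intro mult_imp_div_pos_le) (simp_all only: times_divide_eq_left mult_imp_le_div_pos)
  qed simp
  show "real (Suc j) \<le> (\<Prod>i<h. ?f i j)" for j
  proof -
    have "1 \<le> ?f i j" if "i < h" for i
    proof -
      have "d i * j + e i \<le> 2 * h * j + 2 * i + 1"
        using de[OF that] mult_right_mono[of "d i" "2 * h" j] by linarith
      moreover have "d i * j + e i > 0" using de[OF that] by simp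
      ultimately show ?thesis by (simp only: le_divide_eq_1 of_nat_0_less_iff of_nat_le_iff) simp
    qed
    then have "1 \<le> (\<Prod>i\<in>{..<h}-{0}. ?f i j)" by (intro prod_ge_1) auto
    \<comment> \<open>The factor with index \<open>0\<close> has denominator \<open>1\<close> and
      equals \<open>2 * h * j + 1\<close>.\<close>
    moreover have "real (Suc j) \<le> ?f 0 j"
    proof -
      have "Suc j \<le> 2 * h * j + 1" using assms(3) mult_right_mono[of 1 "2 * h" j] by simp
      then have "real (Suc j) \<le> real (2 * h * j + 1)" by (simp only: of_nat_le_iff)
      then show ?thesis using assms(4,5) by simp
    qed
    ultimately have "real (Suc j) * 1 \<le> ?f 0 j * (\<Prod>i\<in>{..<h}-{0}. ?f i j)"
      by (intro mult_mono) auto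
    also have "\<dots> = (\<Prod>i<h. ?f i j)"
      using assms(3) by (intro prod.remove[symmetric]) auto
    finally show ?thesis by simp
  qed
qed (fact A_0 A_Suc)+

text \<open>Passing from \<open>j\<close> to \<open>Suc j\<close> adds \<open>2 * h\<close> sides
  and multiplies the double factorial by \<open>h\<close> consecutive odd numbers; \<open>d\<close>
  and \<open>e\<close> distribute the new factors of the factorial among them.\<close>

lemma multisection_weighted_growth:
  assumes h: "P * q = 2 * h" "h \<ge> 1" and q: "q > 0" and "d 0 = 0" "e 0 = 1"
    and de: "\<And>i. i < h \<Longrightarrow> 0 < e i \<and> d i \<le> 2 * h \<and> e i \<le> 2 * i + 1 \<and> (2 * i + 1) * d i \<le> 2 * h * e i"
    and fact_shift: "\<And>j. (\<Prod>i<h. d i * j + e i) * fact (q * j) = (fact (q * Suc j) :: nat)"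
  shows "superexponential_growth (fps_multisection q (weighted_fps P 1))
     (\<lambda>j. \<Prod>i<h. real (2 * h * j + 2 * i + 1) / real (d i * j + e i))"
proof (rule superexponential_growth_linear_fractions[OF _ _ h(2) assms(4,5) de])
  have nth: "fps_multisection q (weighted_fps P 1) $ j = real (dfact (int (2 * h * j) - 1)) / fact (q * j)" for j
  proof -
    have eq: "P * (q * j) = 2 * h * j" using h(1) by (simp flip: mult.assoc)
    then have int_eq: "int P * int (q * j) = int (2 * h * j)" by (metis of_nat_mult)
    have "card (surfaces P {1..q * j})
        = (if even (P * (q * j)) then dfact (int P * int (q * j) - 1) else 0)"
      using card_surfaces[of "{1..q * j}" P] by (simp only: card_atLeastAtMost diff_Suc_1 finite_atLeastAtMost)
    also have "\<dots> = dfact (int (2 * h * j) - 1)" unfolding eq int_eq by simp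
    finally show ?thesis by (simp only: weighted_fps_1_nth fps_multisection_nth)
  qed
  show "fps_multisection q (weighted_fps P 1) $ 0 = 1" unfolding nth by (simp add: dfact_nonpos)
  fix j
  let ?d = "\<Prod>i<h. d i * j + e i"
  have "dfact (int (2 * h * Suc j) - 1) = (\<Prod>i<h. 2 * h * j + 2 * i + 1) * dfact (int (2 * h * j) - 1)"
    using dfact_add[of "2 * h * j" h] by (simp add: algebra_simps)
  moreover have "(fact (q * Suc j) :: real) = real ?d * fact (q * j)"
    using arg_cong[OF fact_shift[of j], of real] by (simp only: of_nat_mult of_nat_fact)
  ultimately show "fps_multisection q (weighted_fps P 1) $ Suc j
      = (\<Prod>i<h. real (2 * h * j + 2 * i + 1) / real (d i * j + e i)) * fps_multisection q (weighted_fps P 1) $ j"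
    unfolding nth prod_dividef by (simp only: of_nat_mult of_nat_prod times_divide_times_eq)
qed

lemma num_gluings_odd: "odd (P * n) \<Longrightarrow> num_gluings P n m = 0"
proof -
  assume "odd (P * n)"
  then have "card (perfect_matchings ({1..n} \<times> {..<P})) = 0"
    using card_surfaces[of "{1..n}" P] by (simp add: surfaces_def card_cartesian_product)
  then have "perfect_matchings ({1..n} \<times> {..<P}) = {}"
    by (subst (asm) card_0_eq) (auto intro: finite_perfect_matchings)
  then show ?thesis by (simp add: num_gluings_def gluings_def)
qed

lemma prob_components_eq:
  assumes "even (P * n)"
  shows "prob_components P n m = components_fps P m $ n / weighted_fps P 1 $ n"
proof -
  have "card (surfaces P {1..n}) > 0" using assms by (simp add: card_surfaces dfact_pos)
  then have "surfaces P {1..n} \<noteq> {}" "finite (surfaces P {1..n})" by (auto simp: card_gt_0_iff)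
  moreover have "card (surfaces P {1..n} \<inter> {s. pi0 s = m}) = num_gluings P n m"
  proof -
    have "surfaces P {1..n} \<inter> {s. pi0 s = m} = Pair {1..n} ` gluings P {1..n} m"
      using surfaces_pi0_eq[of P "{1..n}" m] by auto
    then show ?thesis by (simp add: num_gluings_def card_image inj_on_def)
  qed
  ultimately show ?thesis
    by (simp add: prob_components_def measure_pmf_of_set components_fps_def weighted_fps_1_nth)
qed

text \<open>Covers both parities, with \<open>q = 1\<close> or \<open>q = 2\<close>. Division by
  \<open>A $ n\<close> turns shifts of \<open>A\<close> into the functions \<open>?g\<close> up to
  \<open>fact (q * k)\<close>, the factorial that also relates \<open>dcoeff\<close> to the
  coefficients of \<open>E * C (m - 1)\<close>.\<close>

lemma asymp_expansion_multisection:
  assumes m: "m \<ge> 1" and q: "q > 0" and even: "even (P * q)"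
    and odd: "\<And>n. \<not> q dvd n \<Longrightarrow> odd (P * n)"
    and growth: "superexponential_growth (fps_multisection q (weighted_fps P 1)) \<rho>"
  shows "asymp_expansion (\<lambda>n. prob_components P (q * n) m) (\<lambda>k. real_of_int (dcoeff P (q * k) m))
     (\<lambda>k n. real ((q * n) choose (q * k)) *
        (real (dfact (int q * int P * (int n - int k) - 1)) / real (dfact (int q * int P * int n - 1))))"
    (is "asymp_expansion ?p ?c ?g")
proof -
  define A where "A = fps_multisection q (weighted_fps P 1)"
  define E where "E = fps_multisection q (weighted_fps P (- 1))"
  define C where "C = (\<lambda>m. fps_multisection q (components_fps P m))"
  interpret superexponential_growth A \<rho> using growth by (simp add: A_def)
  have weighted0: "weighted_fps P x $ n = 0" if "\<not> q dvd n" for x n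
    using odd[OF that] by (simp add: weighted_fps_def num_gluings_odd)
  have AE: "A * E = 1"
    unfolding A_def E_def using q
    by (simp add: fps_multisection_mult[symmetric] weighted0 weighted_fps_inverse)
  have "\<bar>E $ n\<bar> \<le> A $ n" for n
  proof -
    have "\<bar>\<Sum>m\<le>q * n. real (num_gluings P (q * n) m) * (- 1) ^ m\<bar>
        \<le> (\<Sum>m\<le>q * n. \<bar>real (num_gluings P (q * n) m) * (- 1) ^ m\<bar>)" by (rule sum_abs)
    then show ?thesis by (simp add: A_def E_def weighted_fps_def abs_mult divide_right_mono)
  qed
  then have E: "fps_nth E \<in> O(fps_nth A)"
    using A_pos by (intro bigoI[of _ 1] always_eventually) (simp add: less_imp_le)
  have C_Suc: "fps_euler (C (Suc m)) = fps_euler A * (E * C m)" for m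
  proof -
    have mult_euler: "fps_multisection q (fps_euler (weighted_fps P 1) * G)
        = fps_multisection q (fps_euler (weighted_fps P 1)) * fps_multisection q G" for G
      by (rule fps_multisection_mult[OF q]) (simp add: weighted0)
    have mult_weighted: "fps_multisection q (weighted_fps P (- 1) * G) = E * fps_multisection q G" for G
      unfolding E_def by (rule fps_multisection_mult[OF q weighted0])
    have "of_nat q * fps_euler (C (Suc m)) = fps_multisection q (fps_euler (components_fps P (Suc m)))"
      by (simp add: C_def fps_multisection_euler)
    also have "\<dots> = of_nat q * (fps_euler A * (E * C m))"
      unfolding fps_euler_components_Suc mult_euler mult_weighted fps_multisection_euler
      by (simp only: A_def C_def mult.assoc)
    finally show ?thesis using q by simp
  qed
  have expansion: "has_expansion r (C m) (E * C (m - 1))" for r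
  proof -
    have "C 0 = 1" using q by (simp add: C_def components_fps_0)
    from has_expansion_components[where C = C and m = "m - 1", OF AE E this C_Suc] m
    show ?thesis by simp
  qed
  have c: "?c k = fact (q * k) * (E * C (m - 1)) $ k" for k
    using q m by (simp add: dcoeff_eq E_def C_def fps_multisection_mult[symmetric] weighted0)
  have A_nth: "A $ j = real (dfact (int q * int P * int j - 1)) / fact (q * j)" for j
    using even by (auto simp: A_def weighted_fps_1_nth card_surfaces mult_ac)
  \<comment> \<open>The factorials of the binomial coefficient are those in the denominators of
    \<open>A\<close>. For \<open>k \<le> n\<close> integer and truncated differences agree.\<close>
  have g: "?g k n = A $ (n - k) / A $ n / fact (q * k)" if "k \<le> n" for k n
  proof -
    have int_diff: "int n - int k = int (n - k)" using that by simp
    have choose: "real ((q * n) choose (q * k)) = fact (q * n) / (fact (q * k) * fact (q * (n - k)))"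
      using that by (subst binomial_fact) (auto simp: right_diff_distrib')
    show ?thesis
      unfolding A_nth int_diff choose
      by (simp only: times_divide_times_eq divide_divide_eq_left divide_divide_eq_right
          times_divide_eq_left times_divide_eq_right mult.assoc mult.commute mult.left_commute)
  qed
  have ratio_bigo_g: "(\<lambda>n. A $ (n - k) / A $ n) \<in> O(?g k)" for k
  proof (intro bigoI[of _ "fact (q * k)"] eventually_at_top_linorderI[of k])
    fix n assume n: "k \<le> n"
    show "norm (A $ (n - k) / A $ n) \<le> fact (q * k) * norm (?g k n)"
      unfolding g[OF n] by (simp add: abs_mult)
  qed
  have "?g (Suc k) \<in> o(?g k)" for k
  proof -
    have "(\<lambda>n. inverse (fact (q * Suc k)) * (A $ (n - Suc k) / A $ n)) \<in> o(\<lambda>n. A $ (n - k) / A $ n)"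
      using shift_ratio_smallo[of k] A_pos
      by (intro landau_o.small.cmult_in_iff[THEN iffD2] landau_o.small.divide_right) (auto simp: less_imp_neq[symmetric])
    then have "(\<lambda>n. inverse (fact (q * Suc k)) * (A $ (n - Suc k) / A $ n)) \<in> o(?g k)"
      using ratio_bigo_g by (rule landau_o.small_big_trans)
    then show ?thesis
    proof (rule landau_o.small.in_cong[THEN iffD2, rotated], intro eventually_at_top_linorderI[of "Suc k"])
      fix n assume n: "Suc k \<le> n"
      show "?g (Suc k) n = inverse (fact (q * Suc k)) * (A $ (n - Suc k) / A $ n)"
        unfolding g[OF n] by (simp only: divide_inverse mult.commute)
    qed
  qed
  moreover have "(\<lambda>n. ?p n - (\<Sum>k\<le>r. ?c k * ?g k n)) \<in> O(?g (Suc r))" for r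
  proof -
    have "(\<lambda>n. (C m $ n - (\<Sum>k<Suc r. (E * C (m - 1)) $ k * A $ (n - k))) / A $ n)
        \<in> O(\<lambda>n. A $ (n - Suc r) / A $ n)"
      using expansion[of "Suc r"] A_pos unfolding has_expansion_def
      by (intro landau_o.big.divide_right) (auto simp: less_imp_neq[symmetric])
    also note ratio_bigo_g
    finally have *: "(\<lambda>n. (C m $ n - (\<Sum>k<Suc r. (E * C (m - 1)) $ k * A $ (n - k))) / A $ n)
        \<in> O(?g (Suc r))" .
    show ?thesis
    proof (rule landau_o.big.in_cong[THEN iffD2, OF _ *], rule eventually_at_top_linorderI[of r])
      fix n assume n: "r \<le> n"
      have "?p n = C m $ n / A $ n"
        using even by (subst prob_components_eq) (auto simp: C_def A_def)
      moreover have "(\<Sum>k\<le>r. ?c k * ?g k n) = (\<Sum>k\<le>r. (E * C (m - 1)) $ k * A $ (n - k) / A $ n)"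
      proof (rule sum.cong)
        fix k assume "k \<in> {..r}"
        then have "k \<le> n" using n by simp
        then show "?c k * ?g k n = (E * C (m - 1)) $ k * A $ (n - k) / A $ n"
          unfolding c by (subst g) auto
      qed simp
      ultimately show "?p n - (\<Sum>k\<le>r. ?c k * ?g k n)
          = (C m $ n - (\<Sum>k<Suc r. (E * C (m - 1)) $ k * A $ (n - k))) / A $ n"
        by (simp only: sum_divide_distrib[symmetric] diff_divide_distrib lessThan_Suc_atMost)
    qed
  qed
  ultimately show ?thesis unfolding asymp_expansion_def by blast
qed

text \<open>The single new factor \<open>Suc j\<close> of the factorial goes to the last index,
  where monotonicity reads \<open>2 * h - 1 \<le> 2 * h\<close>. As \<open>h \<ge> 2\<close>, index
  \<open>0\<close> keeps denominator \<open>1\<close>.\<close>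

lemma growth_even:
  assumes "even P" "P \<ge> 3"
  shows "\<exists>\<rho>. superexponential_growth (fps_multisection 1 (weighted_fps P 1)) \<rho>"
proof -
  obtain h where h: "P = 2 * h" using assms by (elim evenE)
  then have "h \<ge> 2" using assms by linarith
  show ?thesis
  proof (rule exI, rule multisection_weighted_growth[where h = h
        and d = "\<lambda>i. if i = h - 1 then 1 else 0" and e = "\<lambda>_. 1"])
    fix j :: nat
    have "(\<Prod>i<h. (if i = h - 1 then 1 else 0) * j + 1) = (\<Prod>i<h. if i = h - 1 then Suc j else 1)"
      by (intro prod.cong) auto
    also have "\<dots> = Suc j" using \<open>h \<ge> 2\<close> by simp
    finally show "(\<Prod>i<h. (if i = h - 1 then 1 else 0) * j + 1) * fact (1 * j) = (fact (1 * Suc j) :: nat)"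
      by simp
  qed (use h \<open>h \<ge> 2\<close> in \<open>auto split: if_splits\<close>)
qed

text \<open>The new factor \<open>2 * j + 1\<close> goes to index \<open>1\<close>, where
  monotonicity requires \<open>6 \<le> 2 * P\<close>, and \<open>2 * j + 2\<close> to index
  \<open>P - 1\<close>. For \<open>P \<ge> 3\<close> these indices are distinct and nonzero.\<close>

lemma growth_odd:
  assumes "odd P" "P \<ge> 3"
  shows "\<exists>\<rho>. superexponential_growth (fps_multisection 2 (weighted_fps P 1)) \<rho>"
proof (rule exI, rule multisection_weighted_growth[where h = P
      and d = "\<lambda>i. if i = 1 \<or> i = P - 1 then 2 else 0" and e = "\<lambda>i. if i = P - 1 then 2 else 1"])
  fix j :: nat
  have "(\<Prod>i<P. (if i = 1 \<or> i = P - 1 then 2 else 0) * j + (if i = P - 1 then 2 else 1))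
      = (\<Prod>i<P. (if i = 1 then 2 * j + 1 else 1) * (if i = P - 1 then 2 * j + 2 else 1))"
    using assms by (intro prod.cong) auto
  also have "\<dots> = (2 * j + 1) * (2 * j + 2)"
    unfolding prod.distrib using assms by simp
  moreover have "fact (2 * Suc j) = (2 * j + 1) * (2 * j + 2) * (fact (2 * j) :: nat)"
    by (simp add: algebra_simps)
  ultimately show "(\<Prod>i<P. (if i = 1 \<or> i = P - 1 then 2 else 0) * j + (if i = P - 1 then 2 else 1)) * fact (2 * j)
      = (fact (2 * Suc j) :: nat)" by (simp only:)
next
  show "0 < (if i = P - 1 then 2 else 1 :: nat) \<and> (if i = 1 \<or> i = P - 1 then 2 else 0) \<le> 2 * P \<and>
      (if i = P - 1 then 2 else 1) \<le> 2 * i + 1 \<and>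
      (2 * i + 1) * (if i = 1 \<or> i = P - 1 then 2 else 0) \<le> 2 * P * (if i = P - 1 then 2 else 1)"
    if "i < P" for i :: nat
  proof -
    consider "i = 1" "i \<noteq> P - 1" | "i = P - 1" | "i \<noteq> 1" "i \<noteq> P - 1" by blast
    then show ?thesis using assms that by cases auto
  qed
qed (use assms in auto)

theorem proposition4p14:
  fixes m P :: nat
  assumes "m \<ge> 1" and "P \<ge> 3"
  shows "(even P \<longrightarrow>
            asymp_expansion
              (\<lambda>n. prob_components P n m)
              (\<lambda>k. real_of_int (dcoeff P k m))
              (\<lambda>k n. real (n choose k) *
                 (real (dfact (int P * (int n - int k) - 1)) / real (dfact (int P * int n - 1))))) \<and>
         (odd P \<longrightarrow>
            asymp_expansion
              (\<lambda>n. prob_components P (2 * n) m)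
              (\<lambda>k. real_of_int (dcoeff P (2 * k) m))
              (\<lambda>k n. real ((2 * n) choose (2 * k)) *
                 (real (dfact (2 * int P * (int n - int k) - 1)) / real (dfact (2 * int P * int n - 1)))))"
proof (intro conjI impI)
  assume "even P"
  then obtain \<rho> where "superexponential_growth (fps_multisection 1 (weighted_fps P 1)) \<rho>"
    using growth_even assms by blast
  from asymp_expansion_multisection[OF assms(1) _ _ _ this] \<open>even P\<close>
  show "asymp_expansion (\<lambda>n. prob_components P n m) (\<lambda>k. real_of_int (dcoeff P k m))
      (\<lambda>k n. real (n choose k) *
         (real (dfact (int P * (int n - int k) - 1)) / real (dfact (int P * int n - 1))))"
    by simp
next
  assume "odd P"
  then obtain \<rho> where "superexponential_growth (fps_multisection 2 (weighted_fps P 1)) \<rho>"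
    using growth_odd assms by blast
  \<comment> \<open>For odd \<open>P\<close> the number of sides \<open>P * n\<close> is odd exactly
    when \<open>2\<close> does not divide \<open>n\<close>.\<close>
  from asymp_expansion_multisection[OF assms(1) _ _ _ this] \<open>odd P\<close>
  show "asymp_expansion (\<lambda>n. prob_components P (2 * n) m) (\<lambda>k. real_of_int (dcoeff P (2 * k) m))
      (\<lambda>k n. real ((2 * n) choose (2 * k)) *
         (real (dfact (2 * int P * (int n - int k) - 1)) / real (dfact (2 * int P * int n - 1))))"
    by simp
qed

end
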